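(* Let $\lambda$ be a cardinal with $\mathrm{cf}(\lambda)=\lambda=\lambda^{\aleph_0}$. Let $\mathcal F$ be a set of partial functions from $\lambda$ to $\lambda$ such that (i) a partial function $f$ from $\lambda$ to $\lambda$ belongs to $\mathcal F$ if and only if $f\restriction u\in\mathcal F$ for every countable $u\subseteq \mathrm{Dom}(f)$, and (ii) there is no $f\in\mathcal F$ with $\mathrm{Dom}(f)=\lambda$. Let $\mathcal T=\mathcal T_{\mathcal F}$ be the tree whose nodes are the $f\in\mathcal F$ whose domain is an ordinal, ordered by inclusion. Then there are non-isomorphic models $M_1,M_2$ (in a common vocabulary), each of cardinality $\lambda$, which are $EF_{\mathcal T,\lambda}$-equivalent.
   Context: For a tree $\mathcal T$, a cardinal $\mu$ and models $M_1,M_2$ with a common vocabulary, the game $\Game_{\mathcal T,\mu}(M_1,M_2)$ between players ISO and AIS is played in stages $\alpha=0,1,2,\dots$; after stage $\alpha$ there is an increasing continuous sequence $\langle f_\beta:\beta\le\alpha\rangle$ of partial isomorphisms from $M_1$ to $M_2$ and an increasing continuous sequence $\langle z_\beta:\beta\le\alpha\rangle$ in $\mathcal T$. At stage $\alpha$, first AIS chooses a node $z_\alpha$ of level $\alpha$ of $\mathcal T$ with $z_\alpha>^{\mathcal T} z_\beta$ for all $\beta<\alpha$. Then: if $\alpha=0$, $f_0=\emptyset$; if $\alpha$ is limit, $f_\alpha=\bigcup_{\beta<\alpha}f_\beta$; if $\alpha=\beta+1$, AIS chooses $A_1\subseteq M_1$, $A_2\subseteq M_2$ with $|A_1\cup A_2|<1+\mu$,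 and ISO must choose a partial isomorphism $f_\alpha$ from $M_1$ to $M_2$ with $f_\beta\subseteq f_\alpha$, $A_1\subseteq\mathrm{Dom}(f_\alpha)$, $A_2\subseteq\mathrm{Rang}(f_\alpha)$. The first player who cannot make a legal move loses; if ISO never loses, ISO wins. $M_1,M_2$ are $EF_{\mathcal T,\mu}$-equivalent if ISO has a winning strategy in $\Game_{\mathcal T,\mu}(M_1,M_2)$. *)

theory Defs
  imports "HOL-Library.Countable_Set" "HOL-Library.FuncSet"
begin

unbundle cardinal_syntax

section \<open>Vocabularies and models\<close>

text \<open>
  For models with universe in an infinite type \<open>'a\<close>, symbols taken from \<open>'a set\<close> lose no generality:
  symbols of the same kind and arity with the same interpretations in both models are redundant,
  and there are at most \<open>2^|'a|\<close> pairs of interpretations.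
\<close>

record ('f, 'r) vocabulary =
  Funs :: "'f set"
  Rels :: "'r set"
  farity :: "'f \<Rightarrow> nat"
  rarity :: "'r \<Rightarrow> nat"

record ('f, 'r, 'm) model =
  universe :: "'m set"
  finterp :: "'f \<Rightarrow> 'm list \<Rightarrow> 'm"
  rinterp :: "'r \<Rightarrow> 'm list set"

definition tuples :: "'m set \<Rightarrow> nat \<Rightarrow> 'm list set" where
  "tuples A n = {xs. set xs \<subseteq> A \<and> length xs = n}"

definition is_model :: "('f, 'r) vocabulary \<Rightarrow> ('f, 'r, 'm) model \<Rightarrow> bool" where
  "is_model V M \<longleftrightarrow> universe M \<noteq> {} \<and>
     (\<forall>g \<in> Funs V. \<forall>xs \<in> tuples (universe M) (farity V g). finterp M g xs \<in> universe M) \<and>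
     (\<forall>R \<in> Rels V. rinterp M R \<subseteq> tuples (universe M) (rarity V R))"

definition isomorphic ::
  "('f, 'r) vocabulary \<Rightarrow> ('f, 'r, 'm) model \<Rightarrow> ('f, 'r, 'n) model \<Rightarrow> bool" where
  "isomorphic V M N \<longleftrightarrow> (\<exists>h. bij_betw h (universe M) (universe N) \<and>
     (\<forall>g \<in> Funs V. \<forall>xs \<in> tuples (universe M) (farity V g).
        h (finterp M g xs) = finterp N g (map h xs)) \<and>
     (\<forall>R \<in> Rels V. \<forall>xs \<in> tuples (universe M) (rarity V R).
        xs \<in> rinterp M R \<longleftrightarrow> map h xs \<in> rinterp N R))"

datatype ('f, vars: 'v) trm = Var 'v | Fn 'f "('f, 'v) trm list"

datatype ('f, 'r, avars: 'v) atom = Eq "('f, 'v) trm" "('f, 'v) trm" | Rel 'r "('f, 'v) trm list"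

fun wf_trm :: "('f, 'r) vocabulary \<Rightarrow> ('f, 'v) trm \<Rightarrow> bool" where
  "wf_trm V (Var v) \<longleftrightarrow> True"
| "wf_trm V (Fn g ts) \<longleftrightarrow> g \<in> Funs V \<and> length ts = farity V g \<and> (\<forall>t \<in> set ts. wf_trm V t)"

fun wf_atom :: "('f, 'r) vocabulary \<Rightarrow> ('f, 'r, 'v) atom \<Rightarrow> bool" where
  "wf_atom V (Eq s t) \<longleftrightarrow> wf_trm V s \<and> wf_trm V t"
| "wf_atom V (Rel R ts) \<longleftrightarrow> R \<in> Rels V \<and> length ts = rarity V R \<and> (\<forall>t \<in> set ts. wf_trm V t)"

fun eval_trm :: "('f, 'r, 'm) model \<Rightarrow> ('v \<Rightarrow> 'm) \<Rightarrow> ('f, 'v) trm \<Rightarrow> 'm" where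
  "eval_trm M e (Var v) = e v"
| "eval_trm M e (Fn g ts) = finterp M g (map (eval_trm M e) ts)"

fun sat :: "('f, 'r, 'm) model \<Rightarrow> ('v \<Rightarrow> 'm) \<Rightarrow> ('f, 'r, 'v) atom \<Rightarrow> bool" where
  "sat M e (Eq s t) \<longleftrightarrow> eval_trm M e s = eval_trm M e t"
| "sat M e (Rel R ts) \<longleftrightarrow> map (eval_trm M e) ts \<in> rinterp M R"

text \<open>
  A partial isomorphism is a partial injection preserving and reflecting every atomic formula
  whose variables are assigned elements of its domain.  Its domain need not be closed under the
  functions of the vocabulary, so the empty map is one exactly when the two models agree on the
  atomic sentences.
\<close>

definition partial_iso ::
  "('f, 'r) vocabulary \<Rightarrow> ('f, 'r, 'm) model \<Rightarrow> ('f, 'r, 'n) model \<Rightarrow> ('m \<rightharpoonup> 'n) \<Rightarrow> bool" where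
  "partial_iso V M N f \<longleftrightarrow> dom f \<subseteq> universe M \<and> ran f \<subseteq> universe N \<and> inj_on f (dom f) \<and>
     (\<forall>(\<phi> :: ('f, 'r, nat) atom) e. wf_atom V \<phi> \<and> e ` avars \<phi> \<subseteq> dom f \<longrightarrow>
        (sat M e \<phi> \<longleftrightarrow> sat N (\<lambda>i. the (f (e i))) \<phi>))"

section \<open>Trees and levels\<close>

text \<open>
  A tree is given by its reflexive partial order \<open>T\<close>, whose field is the set of nodes; the strict
  predecessors \<open>underS T z\<close> of each node \<open>z\<close> are well-ordered.  The level of \<open>z\<close> is the order type
  of \<open>underS T z\<close>.  It has cardinality at most that of the set of nodes, so all levels are ordinals
  below the successor cardinal of \<open>|Field T|\<close>.  The elements \<open>\<alpha>\<close> of that cardinal (a well-order)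
  play the role of these ordinals: \<open>\<alpha>\<close> stands for the order type of its initial
  segment \<open>underS (ords T) \<alpha>\<close>.
\<close>

type_synonym 't ordinal = "'t set"

definition is_tree :: "'t rel \<Rightarrow> bool" where
  "is_tree T \<longleftrightarrow> Partial_order T \<and> (\<forall>z \<in> Field T. Well_order (Restr T (underS T z)))"

definition ords :: "'t rel \<Rightarrow> 't ordinal rel" where
  "ords T = cardSuc |Field T|"

definition has_level :: "'t rel \<Rightarrow> 't \<Rightarrow> 't ordinal \<Rightarrow> bool" where
  "has_level T z \<alpha> \<longleftrightarrow> z \<in> Field T \<and> \<alpha> \<in> Field (ords T) \<and>
     Restr T (underS T z) =o Restr (ords T) (underS (ords T) \<alpha>)"

lemma tree_level_ex1:
  assumes T: "is_tree T" and z: "z \<in> Field T"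
  shows "\<exists>!\<alpha>. has_level T z \<alpha>"
proof -
  let ?P = "Restr T (underS T z)" and ?O = "ords T"
  have co: "Card_order ?O" unfolding ords_def by (rule cardSuc_Card_order[OF card_of_Card_order])
  then have wo: "Well_order ?O" by (simp add: card_order_on_well_order_on)
  have wP: "Well_order ?P" using T z by (auto simp: is_tree_def)
  have "?P <o ?O"
  proof (rule ccontr)
    assume "\<not> ?P <o ?O"
    then have "?O \<le>o ?P" using wo wP not_ordLess_iff_ordLeq by blast
    then have "|Field ?O| \<le>o |Field ?P|" by (rule card_of_mono2)
    moreover have "Field ?P \<subseteq> Field T" by (auto simp: Field_def)
    then have "|Field ?P| \<le>o |Field T|" by (rule card_of_mono1)
    ultimately have "|Field ?O| \<le>o |Field T|" by (rule ordLeq_transitive)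
    then have "?O \<le>o |Field T|"
      using card_of_Field_ordIso[OF co] ordIso_symmetric ordIso_ordLeq_trans by blast
    moreover have "|Field T| <o ?O"
      unfolding ords_def by (rule cardSuc_greater[OF card_of_Card_order])
    ultimately show False using not_ordLess_ordLeq by blast
  qed
  then obtain \<alpha> where \<alpha>: "\<alpha> \<in> Field ?O" "?P =o Restr ?O (underS ?O \<alpha>)"
    using ordLess_iff_ordIso_Restr[OF wo wP] by blast
  have uniq: False if "\<beta> \<in> Field ?O" "\<gamma> \<in> Field ?O" "(\<beta>, \<gamma>) \<in> ?O" "\<beta> \<noteq> \<gamma>"
    and eq: "Restr ?O (underS ?O \<beta>) =o Restr ?O (underS ?O \<gamma>)" for \<beta> \<gamma>
  proof -
    interpret wo_rel ?O using wo by (simp add: wo_rel_def)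
    have "Order_Relation.underS ?O \<beta> \<subset> Order_Relation.underS ?O \<gamma>"
      using that(3,4) ANTISYM TRANS by (auto simp: underS_def antisym_def dest: transD)
    moreover have "Order_Relation.ofilter ?O (Order_Relation.underS ?O \<beta>)" "Order_Relation.ofilter ?O (Order_Relation.underS ?O \<gamma>)"
      by (simp_all add: underS_ofilter)
    ultimately have "Restr ?O (Order_Relation.underS ?O \<beta>) <o Restr ?O (Order_Relation.underS ?O \<gamma>)"
      using ofilter_subset_ordLess[OF wo] by blast
    with eq show False using not_ordLess_ordIso by blast
  qed
  have "\<beta> = \<gamma>" if "has_level T z \<beta>" "has_level T z \<gamma>" for \<beta> \<gamma>
  proof -
    have "Restr ?O (underS ?O \<beta>) =o Restr ?O (underS ?O \<gamma>)"
      "Restr ?O (underS ?O \<gamma>) =o Restr ?O (underS ?O \<beta>)"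
      using that unfolding has_level_def by (meson ordIso_symmetric ordIso_transitive)+
    moreover have "\<beta> \<in> Field ?O" "\<gamma> \<in> Field ?O" using that by (auto simp: has_level_def)
    moreover have "\<beta> = \<gamma> \<or> (\<beta>, \<gamma>) \<in> ?O \<or> (\<gamma>, \<beta>) \<in> ?O"
      using wo calculation(3,4)
      by (auto simp: well_order_on_def linear_order_on_def total_on_def)
    ultimately show ?thesis using uniq by metis
  qed
  moreover have "has_level T z \<alpha>" using \<alpha> z by (simp add: has_level_def)
  ultimately show ?thesis by blast
qed

definition is_succ :: "'o rel \<Rightarrow> 'o \<Rightarrow> 'o \<Rightarrow> bool" where
  "is_succ r \<beta> \<alpha> \<longleftrightarrow> \<beta> \<in> Field r \<and> \<alpha> \<in> Field r \<and> underS r \<alpha> = under r \<beta>"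

section \<open>The game\<close>

text \<open>
  \<open>z \<alpha>\<close>, \<open>A1 \<alpha>\<close>, \<open>A2 \<alpha>\<close> are the choices of AIS at stage \<open>\<alpha>\<close> (the last two matter only
  at successor stages) and \<open>f \<alpha>\<close> is the map at stage \<open>\<alpha>\<close>.  Continuity of \<open>z\<close> needs
  no separate clause: at a limit stage, a node of that level above all earlier \<open>z \<beta>\<close> is a minimal
  upper bound of them.
\<close>

definition AIS_legal ::
  "'t rel \<Rightarrow> 'u rel \<Rightarrow> ('f, 'r, 'm) model \<Rightarrow> ('f, 'r, 'm) model \<Rightarrow>
   ('t ordinal \<Rightarrow> 't) \<Rightarrow> ('t ordinal \<Rightarrow> 'm set) \<Rightarrow> ('t ordinal \<Rightarrow> 'm set) \<Rightarrow> 't ordinal \<Rightarrow> bool" where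
  "AIS_legal T \<mu> M1 M2 z A1 A2 \<alpha> \<longleftrightarrow>
     has_level T (z \<alpha>) \<alpha> \<and>
     (\<forall>\<beta> \<in> underS (ords T) \<alpha>. z \<beta> \<in> underS T (z \<alpha>)) \<and>
     ((\<exists>\<beta>. is_succ (ords T) \<beta> \<alpha>) \<longrightarrow>
        A1 \<alpha> \<subseteq> universe M1 \<and> A2 \<alpha> \<subseteq> universe M2 \<and> |A1 \<alpha> \<union> A2 \<alpha>| <o cone +c \<mu>)"

definition ISO_legal ::
  "'t rel \<Rightarrow> ('f, 'r) vocabulary \<Rightarrow> ('f, 'r, 'm) model \<Rightarrow> ('f, 'r, 'm) model \<Rightarrow>
   ('t ordinal \<Rightarrow> 'm set) \<Rightarrow> ('t ordinal \<Rightarrow> 'm set) \<Rightarrow> ('t ordinal \<Rightarrow> 'm \<rightharpoonup> 'm) \<Rightarrow> 't ordinal \<Rightarrow> bool" where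
  "ISO_legal T V M1 M2 A1 A2 f \<alpha> \<longleftrightarrow>
     partial_iso V M1 M2 (f \<alpha>) \<and>
     (\<forall>\<beta>. is_succ (ords T) \<beta> \<alpha> \<longrightarrow> f \<beta> \<subseteq>\<^sub>m f \<alpha> \<and> A1 \<alpha> \<subseteq> dom (f \<alpha>) \<and> A2 \<alpha> \<subseteq> ran (f \<alpha>))"

text \<open>
  A strategy of ISO takes a successor stage \<open>\<alpha>\<close>, the choices of AIS up to and including \<open>\<alpha>\<close>, and
  the maps before \<open>\<alpha>\<close>.
\<close>

type_synonym ('t, 'm) strategy =
  "'t ordinal \<Rightarrow> ('t ordinal \<Rightarrow> 't) \<Rightarrow> ('t ordinal \<Rightarrow> 'm set) \<Rightarrow> ('t ordinal \<Rightarrow> 'm set) \<Rightarrow>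
   ('t ordinal \<Rightarrow> 'm \<rightharpoonup> 'm) \<Rightarrow> 'm \<rightharpoonup> 'm"

text \<open>
  Every stage without immediate predecessor is \<open>0\<close> or a limit; at \<open>0\<close> the union below is empty.
\<close>

definition follows ::
  "'t rel \<Rightarrow> ('t, 'm) strategy \<Rightarrow> ('t ordinal \<Rightarrow> 't) \<Rightarrow> ('t ordinal \<Rightarrow> 'm set) \<Rightarrow> ('t ordinal \<Rightarrow> 'm set) \<Rightarrow>
   ('t ordinal \<Rightarrow> 'm \<rightharpoonup> 'm) \<Rightarrow> 't ordinal \<Rightarrow> bool" where
  "follows T \<sigma> z A1 A2 f \<alpha> \<longleftrightarrow>
     (if \<exists>\<beta>. is_succ (ords T) \<beta> \<alpha>
      then f \<alpha> = \<sigma> \<alpha> (restrict z (under (ords T) \<alpha>)) (restrict A1 (under (ords T) \<alpha>))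
                     (restrict A2 (under (ords T) \<alpha>)) (restrict f (underS (ords T) \<alpha>))
      else \<forall>x y. f \<alpha> x = Some y \<longleftrightarrow> (\<exists>\<beta> \<in> underS (ords T) \<alpha>. f \<beta> x = Some y))"

definition winning_strategy ::
  "'t rel \<Rightarrow> 'u rel \<Rightarrow> ('f, 'r) vocabulary \<Rightarrow> ('f, 'r, 'm) model \<Rightarrow> ('f, 'r, 'm) model \<Rightarrow>
   ('t, 'm) strategy \<Rightarrow> bool" where
  "winning_strategy T \<mu> V M1 M2 \<sigma> \<longleftrightarrow>
     (\<forall>\<alpha> z A1 A2 f.
        \<alpha> \<in> Field (ords T) \<and>
        (\<forall>\<beta> \<in> under (ords T) \<alpha>. AIS_legal T \<mu> M1 M2 z A1 A2 \<beta> \<and> follows T \<sigma> z A1 A2 f \<beta>) \<longrightarrow>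
        ISO_legal T V M1 M2 A1 A2 f \<alpha>)"

definition EF_equivalent ::
  "'t rel \<Rightarrow> 'u rel \<Rightarrow> ('f, 'r) vocabulary \<Rightarrow> ('f, 'r, 'm) model \<Rightarrow> ('f, 'r, 'm) model \<Rightarrow> bool" where
  "EF_equivalent T \<mu> V M1 M2 \<longleftrightarrow> (\<exists>\<sigma>. winning_strategy T \<mu> V M1 M2 \<sigma>)"

section \<open>The tree of a family of partial functions\<close>

text \<open>
  A cardinal \<open>\<kappa>\<close> is a well-order relation with \<open>Card_order \<kappa>\<close>; the elements of the set \<open>\<kappa>\<close> are those
  of \<open>Field \<kappa>\<close>, and the ordinals \<open>\<le> \<kappa>\<close> are the initial segments of \<open>\<kappa>\<close>.
\<close>

definition partial_functions :: "'a rel \<Rightarrow> ('a \<rightharpoonup> 'a) set" where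
  "partial_functions \<kappa> = {f. dom f \<subseteq> Field \<kappa> \<and> ran f \<subseteq> Field \<kappa>}"

definition family_tree :: "'a rel \<Rightarrow> ('a \<rightharpoonup> 'a) set \<Rightarrow> ('a \<rightharpoonup> 'a) rel" where
  "family_tree \<kappa> \<F> = {(f, g). f \<in> \<F> \<and> g \<in> \<F> \<and> Order_Relation.ofilter \<kappa> (dom f) \<and>
     Order_Relation.ofilter \<kappa> (dom g) \<and> f \<subseteq>\<^sub>m g}"

lemma is_tree_family_tree:
  assumes wo: "Well_order \<kappa>"
  shows "is_tree (family_tree \<kappa> \<F>)"
proof -
  let ?T = "family_tree \<kappa> \<F>"
  interpret wo_rel \<kappa> using wo by (simp add: wo_rel_def)
  have TI: "(f, g) \<in> ?T \<longleftrightarrow> f \<in> \<F> \<and> g \<in> \<F> \<and> Order_Relation.ofilter \<kappa> (dom f) \<and>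
     Order_Relation.ofilter \<kappa> (dom g) \<and> f \<subseteq>\<^sub>m g" for f g
    by (simp add: family_tree_def)
  have refl: "(f, f) \<in> ?T" if "f \<in> Field ?T" for f
    using that by (auto simp: Field_def TI)
  have tr: "trans ?T" by (auto intro!: transI simp: TI intro: map_le_trans)
  have anti: "antisym ?T" by (auto intro!: antisymI simp: TI intro: map_le_antisym)
  have po: "Partial_order ?T"
    using refl tr anti unfolding order_on_defs refl_on_def by (auto simp: Field_def)
  have "Well_order (Restr ?T (Order_Relation.underS ?T z))" if "z \<in> Field ?T" for z
  proof -
    let ?A = "Order_Relation.underS ?T z" and ?P = "Restr ?T (Order_Relation.underS ?T z)"
    have A: "f \<in> \<F>" "Order_Relation.ofilter \<kappa> (dom f)" "f \<subseteq>\<^sub>m z" "f \<noteq> z" "f \<in> Field ?T"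
      if "f \<in> ?A" for f
      using that by (auto simp: underS_def TI Field_def)
    have FP: "Field ?P = ?A"
    proof
      show "Field ?P \<subseteq> ?A" by (auto simp: Field_def)
      show "?A \<subseteq> Field ?P"
      proof
        fix f assume "f \<in> ?A"
        then have "(f, f) \<in> ?P" using refl A(5) by blast
        then show "f \<in> Field ?P" by (rule FieldI1)
      qed
    qed
    have seg: "\<exists>a \<in> Field \<kappa>. dom f = Order_Relation.underS \<kappa> a" if "f \<in> ?A" for f
    proof -
      have "Order_Relation.ofilter \<kappa> (dom z)" using \<open>z \<in> Field ?T\<close> by (auto simp: Field_def TI)
      then have "dom z \<subseteq> Field \<kappa>" by (auto simp: ofilter_def)
      moreover have "dom f \<noteq> dom z" using A(3,4)[OF that] by (metis map_le_antisym map_le_def)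
      moreover have "dom f \<subseteq> dom z" using A(3)[OF that] by (rule map_le_implies_dom_le)
      ultimately have "dom f \<noteq> Field \<kappa>" by blast
      then show ?thesis using A(2)[OF that] ofilter_underS_Field by blast
    qed
    then obtain h where h: "\<And>f. f \<in> ?A \<Longrightarrow> h f \<in> Field \<kappa> \<and> dom f = Order_Relation.underS \<kappa> (h f)" by metis
    have le: "(f, g) \<in> ?T" if "f \<in> ?A" "g \<in> ?A" "dom f \<subseteq> dom g" for f g
    proof -
      have "f \<subseteq>\<^sub>m g" using A(3)[OF that(1)] A(3)[OF that(2)] that(3)
        unfolding map_le_def by (metis subsetD)
      then show ?thesis using A that by (simp add: TI)
    qed
    have tot: "(f, g) \<in> ?T \<or> (g, f) \<in> ?T" if "f \<in> ?A" "g \<in> ?A" for f g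
      using le[OF that] le[OF that(2) that(1)] ofilter_linord[OF A(2)[OF that(1)] A(2)[OF that(2)]]
      by blast
    have "?P - Id \<subseteq> inv_image (\<kappa> - Id) h"
    proof safe
      fix f g assume fg: "(f, g) \<in> ?T" "f \<in> ?A" "g \<in> ?A" "(f, g) \<notin> inv_image (\<kappa> - Id) h"
      then have "(h g, h f) \<in> \<kappa>"
        using h[of f] h[of g] TOTALS REFL by (auto simp: refl_on_def)
      then have "Order_Relation.underS \<kappa> (h g) \<subseteq> Order_Relation.underS \<kappa> (h f)"
        by (rule underS_incr[OF TRANS ANTISYM])
      then have "(g, f) \<in> ?T" using le[OF fg(3) fg(2)] h[OF fg(2)] h[OF fg(3)] by simp
      then show "f = g" using fg(1) anti by (meson antisymD)
    qed
    then have "wf (?P - Id)" by (rule wf_subset[OF wf_inv_image[OF WF]])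
    moreover have "Linear_order ?P"
    proof -
      have "refl_on ?A ?P" using refl A(5) by (intro refl_onI) blast
      moreover have "trans ?P" using tr by (rule trans_Restr)
      moreover have "antisym ?P" using anti by (rule antisym_Restr)
      moreover have "total_on ?A ?P" using tot by (intro total_onI) blast
      ultimately show ?thesis unfolding order_on_defs FP by blast
    qed
    ultimately show ?thesis by (simp add: well_order_on_def)
  qed
  with po show ?thesis by (simp add: is_tree_def)
qed

end

theory Submission
  imports Defs "HOL-Library.Countable_Set_Type"
begin

text \<open>
  The elements of both models are pairs of a countable set \<open>u\<close> of coordinates and a finite set of
  local codes on \<open>u\<close>; the relations say that one element is the projection of another, and the two
  models differ only in which parity of the finite set is distinguished.  Adding to every finite
  set the restriction of one fixed code is a partial isomorphism on the elements whose coordinates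
  lie in the domain of the code.  Conversely, an isomorphism yields a coherent system of finite
  sets of odd size, hence, the countable sets being countably directed, a total function all of
  whose countable restrictions are local codes.

  A code cannot be just the branch played by AIS, since AIS may mention coordinates far beyond the
  current node.  So a code also carries ordinals chosen by ISO, which bound what AIS mentions at
  each stage, and a coordinate below such a bound asks about no later part of the branch.  Regularity of
  \<open>\<kappa>\<close> shows that a total locally coded function still decodes to a total member of \<open>\<F>\<close>.
\<close>

section \<open>Partial isomorphisms\<close>

text \<open>The truth value of an atomic formula depends only on the values at its variables, and
  these lie in \<open>dom f\<close>. At limit stages the map of the game is known only to lie below
  such a \<open>g\<close>.\<close>

lemma partial_iso_submap:
  assumes "partial_iso V M N g" "f \<subseteq>\<^sub>m g"
  shows "partial_iso V M N f"
proof -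
  have g: "dom g \<subseteq> universe M" "ran g \<subseteq> universe N" "inj_on g (dom g)"
    "\<And>(\<phi> :: ('a, 'b, nat) atom) e. wf_atom V \<phi> \<Longrightarrow> e ` avars \<phi> \<subseteq> dom g \<Longrightarrow>
      sat M e \<phi> \<longleftrightarrow> sat N (\<lambda>i. the (g (e i))) \<phi>"
    using assms(1) unfolding partial_iso_def by blast+
  have dom: "dom f \<subseteq> dom g" using assms(2) by (rule map_le_implies_dom_le)
  have eq: "f x = g x" if "x \<in> dom f" for x using assms(2) that by (auto simp: map_le_def)
  have "ran f \<subseteq> ran g"
    using eq by (force simp: ran_def dom_def)
  moreover have "inj_on f (dom f)"
    using g(3) dom eq by (metis inj_on_cong inj_on_subset)
  moreover have "sat M e \<phi> \<longleftrightarrow> sat N (\<lambda>i. the (f (e i))) \<phi>"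
    if w: "wf_atom V \<phi>" and e: "e ` avars \<phi> \<subseteq> dom f" for \<phi> :: "('a, 'b, nat) atom" and e
  proof -
    have tcong: "eval_trm N e1 t = eval_trm N e2 t" if "\<And>i. i \<in> vars t \<Longrightarrow> e1 i = e2 i"
      for e1 e2 and t :: "('a, nat) trm"
      using that
    proof (induction t)
      case (Fn g ts)
      then have "map (eval_trm N e1) ts = map (eval_trm N e2) ts" by (auto intro!: map_cong)
      then show ?case by (simp only: eval_trm.simps)
    qed simp
    have "sat N e1 \<phi> = sat N e2 \<phi>" if "\<And>i. i \<in> avars \<phi> \<Longrightarrow> e1 i = e2 i" for e1 e2
    proof (cases \<phi>)
      case (Eq s t)
      with that show ?thesis using tcong[of s e1 e2] tcong[of t e1 e2] by simp
    next
      case (Rel R ts)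
      have "map (eval_trm N e1) ts = map (eval_trm N e2) ts"
        using that Rel by (auto intro!: tcong)
      with Rel show ?thesis by (simp only: sat.simps)
    qed
    moreover have "the (f (e i)) = the (g (e i))" if "i \<in> avars \<phi>" for i
      using eq[of "e i"] that e by fastforce
    ultimately have "sat N (\<lambda>i. the (f (e i))) \<phi> = sat N (\<lambda>i. the (g (e i))) \<phi>" .
    moreover have "sat M e \<phi> \<longleftrightarrow> sat N (\<lambda>i. the (g (e i))) \<phi>"
      using g(4)[OF w subset_trans[OF e dom]] .
    ultimately show ?thesis by simp
  qed
  ultimately show ?thesis
    using subset_trans[OF dom g(1)] g(2) unfolding partial_iso_def by (simp add: subset_trans)
qed

text \<open>Without function symbols every well-formed term is a variable, so injectivity settles
  the equations and only the relations on elements of the domain remain.\<close>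

lemma partial_iso_relationalI:
  assumes "Funs V = {}" "dom f \<subseteq> universe M" "ran f \<subseteq> universe N" "inj_on f (dom f)"
    and R: "\<And>R xs. R \<in> Rels V \<Longrightarrow> xs \<in> tuples (dom f) (rarity V R) \<Longrightarrow>
      xs \<in> rinterp M R \<longleftrightarrow> map (\<lambda>x. the (f x)) xs \<in> rinterp N R"
  shows "partial_iso V M N f"
proof -
  have "sat M e \<phi> \<longleftrightarrow> sat N (\<lambda>i. the (f (e i))) \<phi>"
    if w: "wf_atom V \<phi>" and e: "e ` avars \<phi> \<subseteq> dom f" for \<phi> :: "('a, 'b, nat) atom" and e
  proof -
    have var: "\<exists>i. t = Var i" if "wf_trm V t" for t :: "('a, nat) trm"
      using that assms(1) by (cases t) auto
    show ?thesis
    proof (cases \<phi>)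
      case (Eq s t)
      then obtain i j where ij: "s = Var i" "t = Var j" using w var by (meson wf_atom.simps(1))
      then have "e i \<in> dom f" "e j \<in> dom f" using e Eq by auto
      then have "the (f (e i)) = the (f (e j)) \<longleftrightarrow> e i = e j"
        using assms(4) by (auto simp: inj_on_def dom_def)
      then show ?thesis using Eq ij by simp
    next
      case (Rel R ts)
      have "\<forall>t\<in>set ts. \<exists>i. t = Var i" using Rel w var by auto
      then obtain js where ts: "ts = map Var js" by (metis ex_map_conv)
      have "map e js \<in> tuples (dom f) (rarity V R)"
        using Rel w e ts by (auto simp: tuples_def)
      then show ?thesis using R[of R "map e js"] Rel w ts by (simp add: comp_def)
    qed
  qed
  then show ?thesis using assms(2-4) unfolding partial_iso_def by blast
qed

section \<open>Coherent systems of finite sets of functions\<close>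

text \<open>Addition of the basis vector \<open>r\<close> to \<open>a\<close>, when finite sets are
  read as vectors over the two-element field.\<close>

definition toggle :: "'x set \<Rightarrow> 'x \<Rightarrow> 'x set" where
  "toggle a r = (if r \<in> a then a - {r} else insert r a)"

lemma toggle_toggle [simp]: "toggle (toggle a r) r = a"
  by (auto simp: toggle_def)

lemma finite_toggle [simp]: "finite (toggle a r) = finite a"
  by (auto simp: toggle_def)

lemma odd_card_toggle:
  assumes "finite a" shows "odd (card (toggle a r)) \<longleftrightarrow> even (card a)"
proof (cases "r \<in> a")
  case True
  then have "card a = Suc (card (a - {r}))" using assms by (metis card_Suc_Diff1)
  then show ?thesis using True by (simp add: toggle_def)
qed (use assms in \<open>simp add: toggle_def\<close>)

text \<open>
  The restriction map on partial functions, extended linearly to the vector spaces over the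
  two-element field that have sets of partial functions as their vectors.
\<close>

definition proj :: "'b set \<Rightarrow> ('b \<rightharpoonup> 'c) set \<Rightarrow> ('b \<rightharpoonup> 'c) set" where
  "proj v a = {q. odd (card {p \<in> a. p |` v = q})}"

lemma proj_empty [simp]: "proj v {} = {}"
  by (simp add: proj_def)

text \<open>A fibre of odd size is nonempty. Equality can fail, since fibres of even size
  cancel.\<close>

lemma proj_subset: "proj v a \<subseteq> (\<lambda>p. p |` v) ` a"
proof
  fix q assume "q \<in> proj v a"
  then have "{p \<in> a. p |` v = q} \<noteq> {}" unfolding proj_def by (metis (mono_tags) card.empty even_zero mem_Collect_eq)
  then show "q \<in> (\<lambda>p. p |` v) ` a" by blast
qed

text \<open>Linearity of the projection: toggling \<open>r\<close> changes a single fibre, the one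
  over the restriction of \<open>r\<close> to \<open>v\<close>, and changes it by one
  element.\<close>

lemma proj_toggle:
  assumes "finite a" shows "proj v (toggle a r) = toggle (proj v a) (r |` v)"
proof -
  have "{p \<in> toggle a r. p |` v = q} =
      (if q = r |` v then toggle {p \<in> a. p |` v = q} r else {p \<in> a. p |` v = q})" for q
    by (auto simp: toggle_def)
  then have "q \<in> proj v (toggle a r) \<longleftrightarrow> (q \<in> proj v a) \<noteq> (q = r |` v)" for q
    using assms by (auto simp: proj_def odd_card_toggle)
  moreover have "q \<in> toggle (proj v a) (r |` v) \<longleftrightarrow> (q \<in> proj v a) \<noteq> (q = r |` v)" for q
    by (auto simp: toggle_def)
  ultimately show ?thesis by blast
qed

text \<open>
  The cardinality of \<open>c u\<close> is monotone in \<open>u\<close>, and the countable sets are closed under countable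
  unions, so it attains a maximum; above a maximizing \<open>u\<close>, restriction is injective on every \<open>c u'\<close>.
\<close>

lemma coherent_finite_sets_thread:
  fixes c :: "'b set \<Rightarrow> ('b \<rightharpoonup> 'c) set"
  assumes fin: "\<And>u. countable u \<Longrightarrow> u \<subseteq> B \<Longrightarrow> finite (c u) \<and> c u \<noteq> {}"
    and coh: "\<And>u v. countable u \<Longrightarrow> u \<subseteq> B \<Longrightarrow> v \<subseteq> u \<Longrightarrow> c v \<subseteq> (\<lambda>q. q |` v) ` c u"
  obtains p where "\<And>w. countable w \<Longrightarrow> w \<subseteq> B \<Longrightarrow>
    \<exists>u q. countable u \<and> w \<subseteq> u \<and> u \<subseteq> B \<and> q \<in> c u \<and> p |` w = q |` w"
proof -
  let ?C = "{u. countable u \<and> u \<subseteq> B}"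
  have mono: "card (c v) \<le> card (c u)" if "u \<in> ?C" "v \<subseteq> u" for u v
    using fin[of u] coh[of u v] that by (auto intro: surj_card_le)
  \<comment> \<open>Otherwise countably many sets with ever larger values would have a union whose
    own value, a single number, bounds them all.\<close>
  have "\<exists>m. \<forall>u\<in>?C. card (c u) \<le> m"
  proof (rule ccontr)
    assume "\<not> ?thesis"
    then have "\<forall>m. \<exists>u. u \<in> ?C \<and> m < card (c u)" by (metis not_le)
    then obtain u where u: "\<And>m. u m \<in> ?C \<and> m < card (c (u m))" by metis
    then have U: "(\<Union>m. u m) \<in> ?C" by auto
    have "card (c (u (card (c (\<Union>m. u m))))) \<le> card (c (\<Union>m. u m))"
      by (rule mono[OF U]) auto
    then show False using u by (metis not_le)
  qed
  then obtain m where m: "\<forall>u. u \<in> ?C \<longrightarrow> card (c u) \<le> m" by blast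
  have "{} \<in> ?C" by simp
  from ex_has_greatest_nat[of "\<lambda>u. u \<in> ?C" "{}" "\<lambda>u. card (c u)" "Suc m", OF this] m
  obtain s where s: "s \<in> ?C" and max: "\<And>u. u \<in> ?C \<Longrightarrow> card (c u) \<le> card (c s)"
    by (auto simp: less_Suc_eq_le)
  have inj: "inj_on (\<lambda>q. q |` s) (c u)" if "u \<in> ?C" "s \<subseteq> u" for u
  proof (rule eq_card_imp_inj_on)
    show f: "finite (c u)" using fin that by auto
    \<comment> \<open>The image of the restriction contains \<open>c s\<close>, whose size is
      already maximal, so no two members are identified.\<close>
    have "card (c s) \<le> card ((\<lambda>q. q |` s) ` c u)"
      using coh[of u s] that f by (auto intro: card_mono)
    then show "card ((\<lambda>q. q |` s) ` c u) = card (c u)"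
      using max[OF that(1)] card_image_le[OF f, of "\<lambda>q. q |` s"] by linarith
  qed
  obtain r where r: "r \<in> c s" using fin s by blast
  \<comment> \<open>A fixed \<open>r\<close> over the maximizing \<open>s\<close> has exactly one
    extension in each \<open>c u\<close> above it, so the choices \<open>t u\<close> cohere.\<close>
  have "\<forall>u. \<exists>q. u \<in> ?C \<and> s \<subseteq> u \<longrightarrow> q \<in> c u \<and> q |` s = r" using coh r by blast
  then obtain t where t: "\<And>u. u \<in> ?C \<Longrightarrow> s \<subseteq> u \<Longrightarrow> t u \<in> c u \<and> t u |` s = r" by metis
  have tcoh: "t v = t u |` v" if "u \<in> ?C" "s \<subseteq> v" "v \<subseteq> u" for u v
  proof -
    have v: "v \<in> ?C" using that countable_subset by auto
    have "t v \<in> (\<lambda>q. q |` v) ` c u" using t[OF v that(2)] coh[of u v] that by blast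
    then obtain q where q: "q \<in> c u" "t v = q |` v" by blast
    have "q |` s = t v |` s" using q that(2) by (simp add: inf.absorb2)
    then have "q |` s = t u |` s" using t[OF v that(2)] t[of u] that by auto
    then have "q = t u" using inj_onD[OF inj[of u]] q(1) t[of u] that by blast
    then show ?thesis using q by simp
  qed
  let ?p = "\<lambda>x. t (insert x s) x"
  have "\<exists>u q. countable u \<and> w \<subseteq> u \<and> u \<subseteq> B \<and> q \<in> c u \<and> ?p |` w = q |` w"
    if "countable w" "w \<subseteq> B" for w
  proof -
    have U: "w \<union> s \<in> ?C" using s that by auto
    have "?p x = t (w \<union> s) x" if "x \<in> w" for x
      using tcoh[OF U, of "insert x s", OF subset_insertI] that by auto
    then have "?p |` w = t (w \<union> s) |` w" by (auto simp: restrict_map_def)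
    then show ?thesis using U t[OF U] by blast
  qed
  then show thesis by (rule that)
qed

section \<open>Counting countable subsets\<close>

lemma card_of_countable_subsets:
  assumes "\<kappa> ^c natLeq =o \<kappa>" "cinfinite \<kappa>" "Card_order \<kappa>" "|B| \<le>o \<kappa>"
  shows "|{u. countable u \<and> u \<subseteq> B}| \<le>o \<kappa>"
proof -
  \<comment> \<open>The bound by the power \<open>|B| ^c natLeq\<close> is for nonempty countable
    sets, which are ranges of sequences; the empty set is added separately.\<close>
  let ?N = "{u. u \<subseteq> B \<and> countable u \<and> u \<noteq> {}}"
  have inf: "infinite (Field \<kappa>)" using assms(2) by (simp add: cinfinite_def)
  have "|?N| \<le>o |B| ^c natLeq" by (rule card_of_countable_sets_Func)
  moreover have "|B| ^c natLeq \<le>o \<kappa> ^c natLeq"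
    using assms(4) natLeq_Card_order by (rule cexp_mono1)
  ultimately have "|?N| \<le>o \<kappa>" using assms(1) by (meson ordLeq_ordIso_trans ordLeq_transitive)
  moreover have "|{{} :: 'b set}| \<le>o \<kappa>"
    using inf assms(3) by (intro Card_order_singl_ordLeq) auto
  ultimately have "|?N \<union> {{}}| \<le>o \<kappa>"
    using card_of_Un_ordLeq_infinite_Field[OF inf _ _ assms(3)] by blast
  moreover have "{u. countable u \<and> u \<subseteq> B} = ?N \<union> {{}}" by auto
  ultimately show ?thesis by (simp only:)
qed

text \<open>The search is confined to stages up to \<open>\<alpha>\<close>, so the value depends
  only on moves that a strategy can see at \<open>\<alpha>\<close>.\<close>

definition entry :: "'o rel \<Rightarrow> ('o \<Rightarrow> 'b \<rightharpoonup> 'c) \<Rightarrow> 'o \<Rightarrow> 'b \<Rightarrow> 'o" where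
  "entry r z \<alpha> \<gamma> =
     (SOME \<beta>. \<beta> \<in> under r \<alpha> \<and> \<gamma> \<in> dom (z \<beta>) \<and> (\<forall>\<beta>' \<in> underS r \<beta>. \<gamma> \<notin> dom (z \<beta>')))"

lemma entry_first:
  assumes "Well_order r" "\<alpha> \<in> Field r" "\<gamma> \<in> dom (z \<alpha>)"
  shows "entry r z \<alpha> \<gamma> \<in> under r \<alpha> \<and> \<gamma> \<in> dom (z (entry r z \<alpha> \<gamma>)) \<and>
    (\<forall>\<beta>' \<in> underS r (entry r z \<alpha> \<gamma>). \<gamma> \<notin> dom (z \<beta>'))"
proof -
  interpret wo: wo_rel r using assms(1) by (simp add: wo_rel_def)
  let ?S = "{\<beta> \<in> Field r. \<gamma> \<in> dom (z \<beta>)}"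
  have S: "?S \<subseteq> Field r" "\<alpha> \<in> ?S" using assms by auto
  then have "wo.minim ?S \<in> ?S" "(wo.minim ?S, \<alpha>) \<in> r" using wo.minim_in wo.minim_least by blast+
  moreover have "\<gamma> \<notin> dom (z \<beta>')" if \<beta>': "\<beta>' \<in> underS r (wo.minim ?S)" for \<beta>'
  proof
    assume "\<gamma> \<in> dom (z \<beta>')"
    moreover have "\<beta>' \<in> Field r" using \<beta>' by (auto simp: underS_def Field_def)
    ultimately have "(wo.minim ?S, \<beta>') \<in> r" using wo.minim_least[OF S(1)] by blast
    then show False using \<beta>' antisymD[OF wo.ANTISYM] unfolding underS_def by blast
  qed
  ultimately have "\<exists>\<beta>. \<beta> \<in> under r \<alpha> \<and> \<gamma> \<in> dom (z \<beta>) \<and> (\<forall>\<beta>' \<in> underS r \<beta>. \<gamma> \<notin> dom (z \<beta>'))"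
    unfolding under_def by blast
  then show ?thesis unfolding entry_def by (rule someI_ex)
qed

lemma entry_eqI:
  assumes "Well_order r" "\<beta> \<in> under r \<alpha>" "\<gamma> \<in> dom (z \<beta>)" "\<forall>\<beta>' \<in> underS r \<beta>. \<gamma> \<notin> dom (z \<beta>')"
  shows "entry r z \<alpha> \<gamma> = \<beta>"
  unfolding entry_def
proof (rule some_equality)
  show "\<beta> \<in> under r \<alpha> \<and> \<gamma> \<in> dom (z \<beta>) \<and> (\<forall>\<beta>' \<in> underS r \<beta>. \<gamma> \<notin> dom (z \<beta>'))"
    using assms by blast
  fix \<delta> assume \<delta>: "\<delta> \<in> under r \<alpha> \<and> \<gamma> \<in> dom (z \<delta>) \<and> (\<forall>\<beta>' \<in> underS r \<delta>. \<gamma> \<notin> dom (z \<beta>'))"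
  interpret wo: wo_rel r using assms(1) by (simp add: wo_rel_def)
  have "\<beta> \<in> Field r" "\<delta> \<in> Field r" using assms(2) \<delta> by (auto simp: under_def Field_def)
  then have "(\<beta>, \<delta>) \<in> r \<or> (\<delta>, \<beta>) \<in> r" using wo.TOTALS by blast
  then show "\<delta> = \<beta>" using assms(3,4) \<delta> unfolding underS_def by blast
qed

section \<open>Positions and their codes\<close>

locale countably_closed_family =
  fixes \<kappa> :: "'a rel" and \<F> :: "('a \<rightharpoonup> 'a) set"
  assumes card_order: "Card_order \<kappa>" and cinfinite: "cinfinite \<kappa>"
    and regular: "regularCard \<kappa>"
    and power: "\<kappa> ^c natLeq =o \<kappa>"
    and family: "\<F> \<subseteq> partial_functions \<kappa>"
    and closed: "\<forall>f \<in> partial_functions \<kappa>.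
           f \<in> \<F> \<longleftrightarrow> (\<forall>u. u \<subseteq> dom f \<and> countable u \<longrightarrow> f |` u \<in> \<F>)"
    and not_total: "\<not> (\<exists>f \<in> \<F>. dom f = Field \<kappa>)"
begin

lemma well_order: "Well_order \<kappa>"
  using card_order by (simp add: card_order_on_well_order_on)

interpretation wo: wo_rel \<kappa>
  using well_order by (simp add: wo_rel_def)

section \<open>Cofinality and uncountability of \<kappa>\<close>

lemma infinite_Field: "infinite (Field \<kappa>)"
  using cinfinite by (simp add: cinfinite_def)

lemma strictly_bounded:
  assumes "E \<subseteq> Field \<kappa>" "|E| <o \<kappa>"
  shows "\<exists>b \<in> Field \<kappa>. E \<subseteq> underS \<kappa> b"
proof -
  have "\<not> cofinal E \<kappa>"
    using assms regular not_ordLess_ordIso unfolding regularCard_def by blast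
  then obtain a where a: "a \<in> Field \<kappa>" "\<And>e. e \<in> E \<Longrightarrow> a = e \<or> (a, e) \<notin> \<kappa>"
    unfolding cofinal_def by blast
  \<comment> \<open>Failure of cofinality yields only a weak bound \<open>a\<close>; a larger
    \<open>b\<close> makes it strict.\<close>
  obtain b where b: "b \<in> Field \<kappa>" "a \<noteq> b" "(a, b) \<in> \<kappa>"
    using infinite_Card_order_limit[OF card_order infinite_Field a(1)] by blast
  have "e \<in> underS \<kappa> b" if "e \<in> E" for e
  proof -
    have "(e, a) \<in> \<kappa>"
      using a that assms(1) wo.TOTALS wo.REFL by (metis subsetD)
    then show ?thesis using b transD[OF wo.TRANS] antisymD[OF wo.ANTISYM]
      unfolding underS_def by blast
  qed
  then show ?thesis using b(1) by blast
qed

text \<open>By Cantor's theorem \<aleph>0 lies below its power set, hence below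
  \<open>\<kappa> ^c natLeq\<close>, that is, below \<kappa>.\<close>

lemma countable_ordLess:
  assumes "countable u" shows "|u| <o \<kappa>"
proof -
  have "|u| \<le>o natLeq"
    using assms by (simp add: countable_card_le_natLeq)
  moreover have "natLeq <o ctwo ^c natLeq" by (rule ordLess_ctwo_cexp[OF natLeq_Card_order])
  moreover have "ctwo ^c natLeq \<le>o \<kappa> ^c natLeq"
    using cinfinite card_order by (intro cexp_mono1 ctwo_ordLeq_Cinfinite natLeq_Card_order) auto
  ultimately show ?thesis
    using power by (meson ordLeq_ordIso_trans ordLeq_ordLess_trans ordLess_ordLeq_trans)
qed

text \<open>
  A position \<open>d\<close> records a node of the tree (in the second components) together with a sequence
  of upper bounds chosen by ISO (in the first components).  In \<open>code d (i, \<epsilon>) = Some (\<gamma>, e, y)\<close>, the ordinal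
  \<open>\<gamma>\<close> is the minimum of \<open>i\<close> and of the first stage whose bound exceeds \<open>\<epsilon>\<close>; so
  a bound declared at one stage forces an isomorphism to know further stages of the branch.
\<close>

definition positions :: "('a \<rightharpoonup> 'a \<times> 'a) set" where
  "positions = {d. Order_Relation.ofilter \<kappa> (dom d) \<and> ran d \<subseteq> Field \<kappa> \<times> Field \<kappa> \<and>
     (\<lambda>\<gamma>. map_option snd (d \<gamma>)) \<in> \<F>}"

definition hits :: "('a \<rightharpoonup> 'a \<times> 'a) \<Rightarrow> 'a \<times> 'a \<Rightarrow> 'a \<Rightarrow> bool" where
  "hits d x \<gamma> \<longleftrightarrow> \<gamma> \<in> dom d \<and> (\<gamma> = fst x \<or> snd x \<in> underS \<kappa> (fst (the (d \<gamma>))))"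

definition code :: "('a \<rightharpoonup> 'a \<times> 'a) \<Rightarrow> 'a \<times> 'a \<rightharpoonup> 'a \<times> 'a \<times> 'a" where
  "code d x = (if \<exists>\<gamma>. hits d x \<gamma>
     then Some (wo_rel.minim \<kappa> {\<gamma>. hits d x \<gamma>}, the (d (wo_rel.minim \<kappa> {\<gamma>. hits d x \<gamma>}))) else None)"

lemma code_eq_Some_iff:
  assumes "dom d \<subseteq> Field \<kappa>"
  shows "code d x = Some (\<gamma>, y) \<longleftrightarrow>
    hits d x \<gamma> \<and> d \<gamma> = Some y \<and> (\<forall>\<gamma>' \<in> underS \<kappa> \<gamma>. \<not> hits d x \<gamma>')"
proof -
  let ?H = "{\<gamma>. hits d x \<gamma>}" and ?m = "wo.minim {\<gamma>. hits d x \<gamma>}"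
  have H: "?H \<subseteq> Field \<kappa>" using assms by (auto simp: hits_def)
  have m: "hits d x ?m \<and> (\<forall>\<gamma>' \<in> underS \<kappa> ?m. \<not> hits d x \<gamma>')" if "hits d x \<delta>" for \<delta>
  proof -
    have ne: "?H \<noteq> {}" using that by blast
    have "\<not> hits d x \<gamma>'" if \<gamma>': "\<gamma>' \<in> underS \<kappa> ?m" for \<gamma>'
    proof
      assume "hits d x \<gamma>'"
      then have "(?m, \<gamma>') \<in> \<kappa>" using wo.minim_least[OF H] by blast
      then show False using \<gamma>' wo.ANTISYM unfolding underS_def by (auto dest: antisymD)
    qed
    then show ?thesis using wo.minim_in[OF H ne] by blast
  qed
  have hit: "code d x = Some (?m, the (d ?m))" if "\<exists>\<gamma>. hits d x \<gamma>"
    using that unfolding code_def by (rule if_P)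
  have uniq: "\<gamma> = ?m" if "hits d x \<gamma>" "\<forall>\<gamma>' \<in> underS \<kappa> \<gamma>. \<not> hits d x \<gamma>'"
  proof -
    have "(?m, \<gamma>) \<in> \<kappa>" using wo.minim_least[OF H] that by blast
    then show ?thesis using m[OF that(1)] that(2) by (auto simp: underS_def)
  qed
  show ?thesis
  proof
    assume c: "code d x = Some (\<gamma>, y)"
    have ex: "\<exists>\<delta>. hits d x \<delta>"
    proof (rule ccontr)
      assume "\<not> ?thesis"
      then have "code d x = None" unfolding code_def by (rule if_not_P)
      with c show False by simp
    qed
    then have "code d x = Some (?m, the (d ?m))" by (rule hit)
    then have "(\<gamma>, y) = (?m, the (d ?m))" using c by (simp only: option.inject)
    then have eq: "\<gamma> = ?m" "y = the (d ?m)" by (simp_all only: prod.inject)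
    have "hits d x ?m \<and> (\<forall>\<gamma>' \<in> underS \<kappa> ?m. \<not> hits d x \<gamma>')" using ex m by blast
    then show "hits d x \<gamma> \<and> d \<gamma> = Some y \<and> (\<forall>\<gamma>' \<in> underS \<kappa> \<gamma>. \<not> hits d x \<gamma>')"
      unfolding eq hits_def[of d x ?m] by auto
  next
    assume *: "hits d x \<gamma> \<and> d \<gamma> = Some y \<and> (\<forall>\<gamma>' \<in> underS \<kappa> \<gamma>. \<not> hits d x \<gamma>')"
    then have \<gamma>: "\<gamma> = ?m" using uniq by blast
    have "\<exists>\<gamma>. hits d x \<gamma>" using * by blast
    then have "code d x = Some (?m, the (d ?m))" by (rule hit)
    then have "code d x = Some (\<gamma>, the (d \<gamma>))" by (simp only: \<gamma>)
    then show "code d x = Some (\<gamma>, y)" using * by simp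
  qed
qed

lemma positions_dom: "d \<in> positions \<Longrightarrow> dom d \<subseteq> Field \<kappa>"
  by (simp add: positions_def wo.ofilter_def)

lemma dom_code: "x \<in> dom (code d) \<longleftrightarrow> (\<exists>\<gamma>. hits d x \<gamma>)"
  by (simp add: code_def dom_def)

text \<open>The domain of \<open>d\<close> is an initial segment, so all indices below a first hit
  of \<open>d\<close> already lie in it, and an extension can add no earlier hit.\<close>

lemma code_mono:
  assumes "d \<in> positions" "d' \<in> positions" "d \<subseteq>\<^sub>m d'"
  shows "code d \<subseteq>\<^sub>m code d'"
proof -
  have eq: "d' \<gamma> = d \<gamma>" if "\<gamma> \<in> dom d" for \<gamma> using assms(3) that by (auto simp: map_le_def)
  have "code d' x = Some (\<gamma>, y)" if *: "code d x = Some (\<gamma>, y)" for x \<gamma> y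
  proof -
    have h: "hits d x \<gamma>" "d \<gamma> = Some y" "\<forall>\<gamma>' \<in> underS \<kappa> \<gamma>. \<not> hits d x \<gamma>'"
      using * code_eq_Some_iff positions_dom assms(1) by blast+
    have "underS \<kappa> \<gamma> \<subseteq> dom d"
      using assms(1) h(2) unfolding positions_def wo.ofilter_def under_def underS_def by blast
    then have "\<forall>\<gamma>' \<in> underS \<kappa> \<gamma>. \<not> hits d' x \<gamma>'"
      using h(3) eq unfolding hits_def by (auto simp: subset_iff)
    moreover have "hits d' x \<gamma>" "d' \<gamma> = Some y"
      using h(1,2) eq[of \<gamma>] by (auto simp: hits_def dom_def)
    ultimately show ?thesis
      using code_eq_Some_iff positions_dom assms(2) by blast
  qed
  then show ?thesis by (auto simp: map_le_def)
qed

text \<open>For each \<open>i\<close> a suitable second coordinate makes \<open>p\<close> reveal the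
  entry at \<open>i\<close> itself instead of an earlier one. The revealed entries decode to a total
  function that agrees on every countable set with a member of \<F>, hence belongs to \<F>.\<close>

lemma locally_coded_impossible:
  assumes loc: "\<And>w. countable w \<Longrightarrow> w \<subseteq> Field \<kappa> \<times> Field \<kappa> \<Longrightarrow>
    \<exists>d \<in> positions. w \<subseteq> dom (code d) \<and> (\<forall>x\<in>w. p x = code d x)"
  shows False
proof -
  have reached: "\<exists>\<epsilon> \<in> Field \<kappa>. \<exists>y. p (i, \<epsilon>) = Some (i, y)" if "i \<in> Field \<kappa>" for i
    using that
  proof (induction i rule: wo.well_order_induct)
    case (1 i)
    have "\<forall>j. \<exists>\<epsilon> y. j \<in> underS \<kappa> i \<longrightarrow> \<epsilon> \<in> Field \<kappa> \<and> p (j, \<epsilon>) = Some (j, y)"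
    proof -
      have "\<exists>\<epsilon> y. \<epsilon> \<in> Field \<kappa> \<and> p (j, \<epsilon>) = Some (j, y)" if "j \<in> underS \<kappa> i" for j
        using 1(1)[rule_format, of j] that FieldI1[of j i \<kappa>] unfolding underS_def by blast
      then show ?thesis by blast
    qed
    then obtain \<epsilon> y where \<epsilon>: "\<And>j. j \<in> underS \<kappa> i \<Longrightarrow> \<epsilon> j \<in> Field \<kappa> \<and> p (j, \<epsilon> j) = Some (j, y j)"
      by metis
    \<comment> \<open>These are the bounds revealed below \<open>i\<close>. There are fewer than
      \<kappa> of them, so regularity provides a second coordinate \<open>b\<close> above them
      all.\<close>
    let ?E = "(\<lambda>j. fst (y j)) ` underS \<kappa> i"
    have "|?E| <o \<kappa>"
      using card_of_underS[OF card_order 1(2)] card_of_image ordLeq_ordLess_trans by blast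
    moreover have "?E \<subseteq> Field \<kappa>"
    proof safe
      fix j assume j: "j \<in> underS \<kappa> i"
      then have "j \<in> Field \<kappa>" by (auto simp: underS_def Field_def)
      then obtain d where d: "d \<in> positions" "p (j, \<epsilon> j) = code d (j, \<epsilon> j)"
        using loc[of "{(j, \<epsilon> j)}"] \<epsilon>[OF j] by auto
      then have "d j = Some (y j)"
        using \<epsilon>[OF j] code_eq_Some_iff[OF positions_dom[OF d(1)]] by metis
      then show "fst (y j) \<in> Field \<kappa>" using d(1) by (auto simp: positions_def ran_def)
    qed
    ultimately obtain b where b: "b \<in> Field \<kappa>" "?E \<subseteq> underS \<kappa> b"
      using strictly_bounded by blast
    obtain d where d: "d \<in> positions" "(i, b) \<in> dom (code d)" "p (i, b) = code d (i, b)"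
      using loc[of "{(i, b)}"] b 1(2) by auto
    then obtain \<gamma> y' where y': "p (i, b) = Some (\<gamma>, y')" by auto
    have "\<gamma> = i"
    proof (rule ccontr)
      assume ne: "\<gamma> \<noteq> i"
      have *: "hits d (i, b) \<gamma>" "\<forall>\<gamma>' \<in> underS \<kappa> \<gamma>. \<not> hits d (i, b) \<gamma>'"
        using y' d code_eq_Some_iff[OF positions_dom[OF d(1)]] by metis+
      then have "\<gamma> \<in> dom d" by (simp add: hits_def)
      \<comment> \<open>If the first hit lay beyond \<open>i\<close>, the domain would contain
        \<open>i\<close>, which would then be an earlier hit.\<close>
      have "i \<notin> underS \<kappa> \<gamma>"
      proof
        assume i: "i \<in> underS \<kappa> \<gamma>"
        then have "i \<in> dom d"
          using \<open>\<gamma> \<in> dom d\<close> d(1) unfolding positions_def wo.ofilter_def under_def underS_def by blast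
        then show False using * i by (auto simp: hits_def)
      qed
      then have g: "\<gamma> \<in> underS \<kappa> i"
        using ne 1(2) \<open>\<gamma> \<in> dom d\<close> positions_dom[OF d(1)] wo.TOTALS by (auto simp: underS_def)
      then have gF: "\<gamma> \<in> Field \<kappa>" by (auto simp: underS_def Field_def)
      \<comment> \<open>One position has to account for both coordinates, so that the bound
        exceeding \<open>b\<close> at \<open>\<gamma>\<close> is the first component of
        \<open>y \<gamma>\<close>, over which \<open>b\<close> was chosen.\<close>
      obtain d' where d': "d' \<in> positions" "p (i, b) = code d' (i, b)"
          "p (\<gamma>, \<epsilon> \<gamma>) = code d' (\<gamma>, \<epsilon> \<gamma>)"
        using loc[of "{(i, b), (\<gamma>, \<epsilon> \<gamma>)}"] b(1) 1(2) \<epsilon>[OF g] gF by auto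
      have "hits d' (i, b) \<gamma>" "d' \<gamma> = Some (y \<gamma>)"
        using y' d'(2,3) \<epsilon>[OF g] code_eq_Some_iff[OF positions_dom[OF d'(1)]] by metis+
      then have "b \<in> underS \<kappa> (fst (y \<gamma>))" using ne by (simp add: hits_def)
      moreover have "fst (y \<gamma>) \<in> underS \<kappa> b" using b(2) g by blast
      ultimately show False using wo.ANTISYM by (auto simp: underS_def antisym_def)
    qed
    then show ?case using b(1) y' by blast
  qed
  then have "\<forall>i. \<exists>\<epsilon> y. i \<in> Field \<kappa> \<longrightarrow> \<epsilon> \<in> Field \<kappa> \<and> p (i, \<epsilon>) = Some (i, y)" by metis
  then obtain \<epsilon> y where \<epsilon>: "\<And>i. i \<in> Field \<kappa> \<Longrightarrow> \<epsilon> i \<in> Field \<kappa> \<and> p (i, \<epsilon> i) = Some (i, y i)"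
    by metis
  define g where "g i = (if i \<in> Field \<kappa> then Some (snd (y i)) else None)" for i
  have dom_g: "dom g = Field \<kappa>" by (auto simp: g_def split: if_splits)
  have local_g: "\<exists>d \<in> positions. \<forall>i\<in>u. d i = Some (y i)" if u: "countable u" "u \<subseteq> Field \<kappa>" for u
  proof -
    have "countable ((\<lambda>i. (i, \<epsilon> i)) ` u)" "(\<lambda>i. (i, \<epsilon> i)) ` u \<subseteq> Field \<kappa> \<times> Field \<kappa>"
      using u \<epsilon> by auto
    then obtain d where d: "d \<in> positions" "\<forall>i\<in>u. p (i, \<epsilon> i) = code d (i, \<epsilon> i)"
      using loc[of "(\<lambda>i. (i, \<epsilon> i)) ` u"] by auto
    have "d i = Some (y i)" if "i \<in> u" for i
      using d(2) that u(2) \<epsilon>[of i] code_eq_Some_iff[OF positions_dom[OF d(1)]] by (metis subsetD)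
    then show ?thesis using d(1) by blast
  qed
  have "snd (y i) \<in> Field \<kappa>" if i: "i \<in> Field \<kappa>" for i
  proof -
    obtain d where "d \<in> positions" "d i = Some (y i)" using local_g[of "{i}"] i by auto
    then show ?thesis by (auto simp: positions_def ran_def)
  qed
  then have "g \<in> partial_functions \<kappa>"
    using dom_g by (auto simp: partial_functions_def ran_def g_def split: if_splits)
  moreover have "g |` u \<in> \<F>" if u: "u \<subseteq> dom g" "countable u" for u
  proof -
    obtain d where d: "d \<in> positions" "\<forall>i\<in>u. d i = Some (y i)" using local_g[OF u(2)] u(1) unfolding dom_g by blast
    let ?z = "\<lambda>\<gamma>. map_option snd (d \<gamma>)"
    have "?z \<in> \<F>" using d(1) by (simp add: positions_def)
    moreover have "u \<subseteq> dom ?z" using d(2) by auto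
    ultimately have "?z |` u \<in> \<F>" using bspec[OF closed, of ?z] family u(2) by blast
    moreover have "?z |` u = g |` u"
      using d(2) u(1) dom_g by (auto simp: fun_eq_iff restrict_map_def g_def)
    ultimately show ?thesis by simp
  qed
  ultimately have "g \<in> \<F>" using bspec[OF closed, of g] by simp
  then show False using not_total dom_g by blast
qed

section \<open>Finite sets of local codes and their number\<close>

definition local_codes :: "('a \<times> 'a) set \<Rightarrow> ('a \<times> 'a \<rightharpoonup> 'a \<times> 'a \<times> 'a) set" where
  "local_codes u = {code d |` u | d. d \<in> positions \<and> u \<subseteq> dom (code d)}"

text \<open>The fibre over \<open>u\<close> is the vector space over the two-element field with
  basis \<open>local_codes u\<close>. Keeping \<open>u\<close> in the pair separates the zero
  vectors \<open>(u, {})\<close>, which the relation symbols name and an isomorphism moves.\<close>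

definition elements :: "(('a \<times> 'a) set \<times> ('a \<times> 'a \<rightharpoonup> 'a \<times> 'a \<times> 'a) set) set" where
  "elements = {(u, a). countable u \<and> u \<subseteq> Field \<kappa> \<times> Field \<kappa> \<and> finite a \<and> a \<subseteq> local_codes u}"

lemma ran_code:
  assumes "d \<in> positions" shows "ran (code d) \<subseteq> Field \<kappa> \<times> Field \<kappa> \<times> Field \<kappa>"
proof -
  have "\<gamma> \<in> Field \<kappa> \<and> y \<in> Field \<kappa> \<times> Field \<kappa>" if "code d x = Some (\<gamma>, y)" for x \<gamma> y
  proof -
    have "d \<gamma> = Some y" using that code_eq_Some_iff[OF positions_dom[OF assms]] by blast
    then have "\<gamma> \<in> dom d" "y \<in> ran d" by (auto intro: ranI)
    then show ?thesis using assms positions_dom[OF assms] unfolding positions_def by blast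
  qed
  then show ?thesis by (fastforce simp: ran_def)
qed

lemma card_elements: "|elements| =o \<kappa>"
proof -
  let ?K = "Field \<kappa>"
  let ?B = "?K \<times> ?K" and ?C = "?K \<times> ?K \<times> ?K"
  \<comment> \<open>A local code has a countable domain, so its graph is a countable subset of a set
    of size \<kappa>; finite sets of local codes are then countable subsets of
    \<open>P\<close>.\<close>
  define P where "P = {p :: 'a \<times> 'a \<rightharpoonup> 'a \<times> 'a \<times> 'a. countable (dom p) \<and> dom p \<subseteq> ?B \<and> ran p \<subseteq> ?C}"
  note subsets = card_of_countable_subsets[OF power cinfinite card_order]
  note times = card_of_Times_ordLeq_infinite_Field[OF infinite_Field _ _ card_order]
  have K: "|?K| \<le>o \<kappa>" using card_of_Field_ordIso[OF card_order] ordIso_imp_ordLeq by blast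
  have "|{G. countable G \<and> G \<subseteq> ?B \<times> ?C}| \<le>o \<kappa>" by (intro subsets times K)
  moreover have "|P| \<le>o |{G. countable G \<and> G \<subseteq> ?B \<times> ?C}|"
  proof -
    have inj: "inj_on Map.graph P"
    proof (rule inj_onI, rule ext)
      fix p q :: "'a \<times> 'a \<rightharpoonup> 'a \<times> 'a \<times> 'a" and x assume "Map.graph p = Map.graph q"
      then have "p x = Some y \<longleftrightarrow> q x = Some y" for y by (metis in_graphI in_graphD)
      then show "p x = q x" by (metis not_Some_eq)
    qed
    have countable: "countable (Map.graph p)" if "p \<in> P" for p
    proof -
      have "Map.graph p = (\<lambda>x. (x, the (p x))) ` dom p" by (force simp: Map.graph_def)
      then show ?thesis using that by (simp add: P_def)
    qed
    have subset: "Map.graph p \<subseteq> ?B \<times> ?C" if "p \<in> P" for p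
    proof -
      have "Map.graph p \<subseteq> dom p \<times> ran p" by (auto simp: Map.graph_def intro: ranI)
      also have "\<dots> \<subseteq> ?B \<times> ?C" using that unfolding P_def by (intro Sigma_mono) auto
      finally show ?thesis .
    qed
    have "Map.graph ` P \<subseteq> {G. countable G \<and> G \<subseteq> ?B \<times> ?C}"
      by (intro image_subsetI CollectI conjI countable subset)
    with inj show ?thesis by (metis (no_types, lifting) card_of_ordLeq)
  qed
  ultimately have "|P| \<le>o \<kappa>" using ordLeq_transitive by blast
  then have "|{u. countable u \<and> u \<subseteq> ?B} \<times> {a. countable a \<and> a \<subseteq> P}| \<le>o \<kappa>"
    by (intro times subsets K)
  moreover have "elements \<subseteq> {u. countable u \<and> u \<subseteq> ?B} \<times> {a. countable a \<and> a \<subseteq> P}"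
  proof -
    have "p \<in> P" if p: "p \<in> local_codes u" and u: "countable u" "u \<subseteq> ?B" for p u
    proof -
      obtain d where d: "d \<in> positions" "u \<subseteq> dom (code d)" "p = code d |` u"
        using p unfolding local_codes_def by blast
      have "ran p \<subseteq> ran (code d)" unfolding d(3) by (auto simp: ran_def restrict_map_def split: if_splits)
      then have "ran p \<subseteq> ?C" using ran_code[OF d(1)] by (rule subset_trans)
      moreover have "dom p = u" using d(2,3) by auto
      ultimately show ?thesis using u by (simp add: P_def)
    qed
    then show ?thesis unfolding elements_def by (auto intro: countable_finite)
  qed
  ultimately have "|elements| \<le>o \<kappa>" by (meson card_of_mono1 ordLeq_transitive)
  moreover have "\<kappa> \<le>o |elements|"
  proof -
    \<comment> \<open>The zero vectors over singletons already suffice.\<close>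
    have "|?K| \<le>o |elements|"
      by (rule card_of_ordLeqI[of "\<lambda>x. ({(x, x)}, {})"]) (auto simp: inj_on_def elements_def)
    then show ?thesis by (rule ordIso_ordLeq_trans[OF ordIso_symmetric[OF card_of_Field_ordIso[OF card_order]]])
  qed
  ultimately show ?thesis by (simp add: ordIso_iff_ordLeq)
qed


section \<open>The models\<close>

text \<open>The fibres are moved onto \<open>Field \<kappa>\<close> along a bijection, so that the
  elements of the models become ordinals below \<kappa>.\<close>

definition enc :: "('a \<times> 'a) set \<times> ('a \<times> 'a \<rightharpoonup> 'a \<times> 'a \<times> 'a) set \<Rightarrow> 'a" where
  "enc = (SOME h. bij_betw h elements (Field \<kappa>))"

definition dec :: "'a \<Rightarrow> ('a \<times> 'a) set \<times> ('a \<times> 'a \<rightharpoonup> 'a \<times> 'a \<times> 'a) set" where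
  "dec = inv_into elements enc"

lemma bij_enc: "bij_betw enc elements (Field \<kappa>)"
proof -
  have "|elements| =o |Field \<kappa>|"
    using card_elements card_of_Field_ordIso[OF card_order] ordIso_symmetric ordIso_transitive by blast
  then have "\<exists>h. bij_betw h elements (Field \<kappa>)" by (simp add: card_of_ordIso)
  then show ?thesis unfolding enc_def by (rule someI_ex)
qed

lemma enc_in_Field: "x \<in> elements \<Longrightarrow> enc x \<in> Field \<kappa>"
  using bij_enc by (rule bij_betwE[THEN bspec])

lemma enc_eq_iff: "x \<in> elements \<Longrightarrow> y \<in> elements \<Longrightarrow> enc x = enc y \<longleftrightarrow> x = y"
  using bij_enc by (meson bij_betw_imp_inj_on inj_on_eq_iff)

lemma dec_enc: "x \<in> elements \<Longrightarrow> dec (enc x) = x"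
  using bij_enc unfolding dec_def by (rule bij_betw_inv_into_left)

lemma Field_encE:
  assumes "m \<in> Field \<kappa>" obtains x where "x \<in> elements" "m = enc x"
  using assms bij_enc unfolding bij_betw_def by blast

lemma empty_in_elements: "countable u \<Longrightarrow> u \<subseteq> Field \<kappa> \<times> Field \<kappa> \<Longrightarrow> (u, {}) \<in> elements"
  by (simp add: elements_def)

lemma fst_in_elements:
  "x \<in> elements \<Longrightarrow> (fst x, {}) \<in> elements"
  by (auto simp: elements_def)

text \<open>
  The symbol \<open>{enc (v, {})}\<close> stands for the graph of the projection to the component over \<open>v\<close>, and
  \<open>{}\<close> for the parity predicate; all other symbols are interpreted by the empty relation.
\<close>

definition vocab :: "('a set, 'a set) vocabulary" where
  "vocab = \<lparr>Funs = {}, Rels = UNIV, farity = (\<lambda>_. 0), rarity = (\<lambda>_. 2)\<rparr>"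

definition parity_model :: "bool \<Rightarrow> ('a set, 'a set, 'a) model" where
  "parity_model b = \<lparr>universe = Field \<kappa>, finterp = (\<lambda>_ _. undefined),
     rinterp = (\<lambda>R. if R = {}
       then {[enc x, enc x] | x. x \<in> elements \<and> (odd (card (snd x)) \<longleftrightarrow> b)}
       else {[enc x, enc y] | x y. x \<in> elements \<and> y \<in> elements \<and> R = {enc (fst y, {})} \<and>
         fst y \<subseteq> fst x \<and> snd y = proj (fst y) (snd x)})\<rparr>"

lemma vocab_simps [simp]: "Funs vocab = {}" "Rels vocab = UNIV" "rarity vocab R = 2"
  by (simp_all add: vocab_def)

lemma universe_parity_model [simp]: "universe (parity_model b) = Field \<kappa>"
  by (simp add: parity_model_def)

text \<open>All symbols are binary, so the parity predicate is kept on the diagonal.\<close>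

lemma rinterp_parity:
  assumes "x \<in> elements" "y \<in> elements"
  shows "[enc x, enc y] \<in> rinterp (parity_model b) {} \<longleftrightarrow> x = y \<and> (odd (card (snd x)) \<longleftrightarrow> b)"
proof -
  have "[enc x, enc y] \<in> rinterp (parity_model b) {} \<longleftrightarrow>
    (\<exists>x'. enc x = enc x' \<and> enc y = enc x' \<and> x' \<in> elements \<and> (odd (card (snd x')) \<longleftrightarrow> b))"
    by (simp add: parity_model_def)
  then show ?thesis using assms enc_eq_iff by metis
qed

lemma rinterp_proj:
  assumes "x \<in> elements" "y \<in> elements" "R \<noteq> {}"
  shows "[enc x, enc y] \<in> rinterp (parity_model b) R \<longleftrightarrow>
    R = {enc (fst y, {})} \<and> fst y \<subseteq> fst x \<and> snd y = proj (fst y) (snd x)"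
proof -
  have "[enc x, enc y] \<in> rinterp (parity_model b) R \<longleftrightarrow>
    (\<exists>x' y'. enc x = enc x' \<and> enc y = enc y' \<and> x' \<in> elements \<and> y' \<in> elements \<and>
       R = {enc (fst y', {})} \<and> fst y' \<subseteq> fst x' \<and> snd y' = proj (fst y') (snd x'))"
    using assms(3) by (simp add: parity_model_def)
  then show ?thesis using assms(1,2) enc_eq_iff by metis
qed

lemma is_model_parity_model: "is_model vocab (parity_model b)"
proof -
  have "Field \<kappa> \<noteq> {}" using infinite_Field by auto
  moreover have "rinterp (parity_model b) R \<subseteq> tuples (Field \<kappa>) 2" for R
    by (auto simp: parity_model_def tuples_def enc_in_Field)
  ultimately show ?thesis by (simp add: is_model_def)
qed

text \<open>An isomorphism would send the zero vectors \<open>(u, {})\<close> to vectors of odd size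
  over the same \<open>u\<close> that match under projection. A thread through these is a total
  locally coded function.\<close>

lemma not_isomorphic: "\<not> isomorphic vocab (parity_model False) (parity_model True)"
proof
  assume "isomorphic vocab (parity_model False) (parity_model True)"
  then obtain h where h: "bij_betw h (Field \<kappa>) (Field \<kappa>)"
    and R: "\<And>R xs. xs \<in> tuples (Field \<kappa>) 2 \<Longrightarrow>
      xs \<in> rinterp (parity_model False) R \<longleftrightarrow> map h xs \<in> rinterp (parity_model True) R"
    unfolding isomorphic_def by auto
  let ?C = "\<lambda>u. countable u \<and> u \<subseteq> Field \<kappa> \<times> Field \<kappa>"
  define t where "t u = dec (h (enc (u, {})))" for u
  define c where "c u = snd (t u)" for u
  have t: "t u \<in> elements" "h (enc (u, {})) = enc (t u)" if u: "?C u" for u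
  proof -
    have "h (enc (u, {})) \<in> Field \<kappa>"
      using h enc_in_Field empty_in_elements u by (meson bij_betwE)
    then show "t u \<in> elements" "h (enc (u, {})) = enc (t u)"
      unfolding t_def by (metis Field_encE dec_enc)+
  qed
  have R': "[enc (u, {}), enc (v, {})] \<in> rinterp (parity_model False) R \<longleftrightarrow>
      [enc (t u), enc (t v)] \<in> rinterp (parity_model True) R" if "?C u" "?C v" for u v R
    using R[of "[enc (u, {}), enc (v, {})]" R] that t
    by (simp add: tuples_def enc_in_Field empty_in_elements)
  \<comment> \<open>Zero vectors project to zero vectors. As the symbol names \<open>v\<close>,
    applying \<open>h\<close> preserves both the index \<open>v\<close> and the projection.\<close>
  have related: "fst (t v) = v \<and> c v = proj v (c u)" if "?C u" "v \<subseteq> u" for u v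
  proof -
    have v: "?C v" using that countable_subset by blast
    have "[enc (u, {}), enc (v, {})] \<in> rinterp (parity_model False) {enc (v, {})}"
      using that v by (simp add: rinterp_proj empty_in_elements)
    then have "[enc (t u), enc (t v)] \<in> rinterp (parity_model True) {enc (v, {})}"
      using R' that(1) v by blast
    then have *: "enc (v, {}) = enc (fst (t v), {})" "snd (t v) = proj (fst (t v)) (snd (t u))"
      using that(1) v t by (simp_all add: rinterp_proj)
    then have "fst (t v) = v"
      using enc_eq_iff empty_in_elements v fst_in_elements t(1) by (metis prod.inject)
    then show ?thesis using * by (simp add: c_def)
  qed
  have codes: "finite (c u)" "c u \<subseteq> local_codes u" if "?C u" for u
    using t(1)[OF that] related[OF that order_refl] unfolding elements_def c_def by auto
  \<comment> \<open>The zero vector has even size, which the first model distinguishes; the second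
    distinguishes odd size.\<close>
  have ne: "c u \<noteq> {}" if "?C u" for u
  proof -
    have "[enc (u, {}), enc (u, {})] \<in> rinterp (parity_model False) {}"
      using that by (simp add: rinterp_parity empty_in_elements)
    then have "odd (card (c u))"
      using R'[OF that that] t(1)[OF that] by (simp add: rinterp_parity c_def)
    then show ?thesis by auto
  qed
  have fin: "finite (c u) \<and> c u \<noteq> {}" if "countable u" "u \<subseteq> Field \<kappa> \<times> Field \<kappa>" for u
    using codes ne that by blast
  have coh: "c v \<subseteq> (\<lambda>q. q |` v) ` c u"
    if "countable u" "u \<subseteq> Field \<kappa> \<times> Field \<kappa>" "v \<subseteq> u" for u v
    using related[of u v] that proj_subset by metis
  obtain p where p: "\<And>w. countable w \<Longrightarrow> w \<subseteq> Field \<kappa> \<times> Field \<kappa> \<Longrightarrow>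
    \<exists>u q. countable u \<and> w \<subseteq> u \<and> u \<subseteq> Field \<kappa> \<times> Field \<kappa> \<and> q \<in> c u \<and> p |` w = q |` w"
  proof (rule coherent_finite_sets_thread[of "Field \<kappa> \<times> Field \<kappa>" c])
    fix p
    assume "\<And>w. countable w \<Longrightarrow> w \<subseteq> Field \<kappa> \<times> Field \<kappa> \<Longrightarrow>
      \<exists>u q. countable u \<and> w \<subseteq> u \<and> u \<subseteq> Field \<kappa> \<times> Field \<kappa> \<and> q \<in> c u \<and> p |` w = q |` w"
    then show thesis by (rule that)
  qed (erule (1) fin, erule (2) coh)
  show False
  proof (rule locally_coded_impossible)
    fix w assume w: "countable w" "w \<subseteq> Field \<kappa> \<times> Field \<kappa>"
    then obtain u q where u: "?C u" "w \<subseteq> u" "q \<in> c u" "p |` w = q |` w" using p[OF w] by blast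
    then obtain d where d: "d \<in> positions" "u \<subseteq> dom (code d)" "q = code d |` u"
      using codes(2)[OF u(1)] unfolding local_codes_def by blast
    have "p x = code d x" if "x \<in> w" for x
      using u(2,4) d(3) that by (metis restrict_in subsetD)
    then show "\<exists>d \<in> positions. w \<subseteq> dom (code d) \<and> (\<forall>x\<in>w. p x = code d x)"
      using d u(2) by blast
  qed
qed

section \<open>Translations by a code\<close>

fun shift :: "('a \<times> 'a \<rightharpoonup> 'a \<times> 'a \<times> 'a) \<Rightarrow>
    ('a \<times> 'a) set \<times> ('a \<times> 'a \<rightharpoonup> 'a \<times> 'a \<times> 'a) set \<Rightarrow>
    ('a \<times> 'a) set \<times> ('a \<times> 'a \<rightharpoonup> 'a \<times> 'a \<times> 'a) set" where
  "shift p (u, a) = (u, toggle a (p |` u))"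

lemma fst_shift [simp]: "fst (shift p x) = fst x"
  by (cases x) simp

lemma snd_shift: "snd (shift p x) = toggle (snd x) (p |` fst x)"
  by (cases x) simp

lemma shift_shift [simp]: "shift p (shift p x) = x"
  by (cases x) simp

lemma shift_in_elements:
  assumes "x \<in> elements" "d \<in> positions" "fst x \<subseteq> dom (code d)"
  shows "shift (code d) x \<in> elements"
proof -
  obtain u a where x: "x = (u, a)" by fastforce
  have "code d |` u \<in> local_codes u" using assms x by (auto simp: local_codes_def)
  then have "toggle a (code d |` u) \<subseteq> local_codes u"
    using assms(1) x by (auto simp: toggle_def elements_def)
  then show ?thesis using assms(1) x by (simp add: elements_def)
qed

text \<open>In each fibre over a subset of the domain of \<open>p\<close>, the restriction of
  \<open>p\<close> is added as a basis vector. Elements with a coordinate outside that domain are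
  left out, since there the restriction is not total.\<close>

definition translation :: "('a \<times> 'a \<rightharpoonup> 'a \<times> 'a \<times> 'a) \<Rightarrow> 'a \<rightharpoonup> 'a" where
  "translation p m = (if m \<in> Field \<kappa> \<and> fst (dec m) \<subseteq> dom p then Some (enc (shift p (dec m))) else None)"

lemma translation_enc:
  "x \<in> elements \<Longrightarrow> translation p (enc x) = (if fst x \<subseteq> dom p then Some (enc (shift p x)) else None)"
  by (simp add: translation_def enc_in_Field dec_enc)

lemma in_dom_translationE:
  assumes "m \<in> dom (translation p)"
  obtains x where "x \<in> elements" "fst x \<subseteq> dom p" "m = enc x" "translation p m = Some (enc (shift p x))"
proof -
  have m: "m \<in> Field \<kappa> \<and> fst (dec m) \<subseteq> dom p"
  proof (rule ccontr)
    assume "\<not> ?thesis"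
    then have "translation p m = None" unfolding translation_def by (rule if_not_P)
    with assms show False by blast
  qed
  then obtain x where "x \<in> elements" "m = enc x" using Field_encE by blast
  then show thesis using that m by (simp add: dec_enc translation_enc)
qed

lemma translation_mono:
  assumes "p \<subseteq>\<^sub>m q" shows "translation p \<subseteq>\<^sub>m translation q"
  unfolding map_le_def
proof
  fix m assume "m \<in> dom (translation p)"
  then obtain x where x: "x \<in> elements" "fst x \<subseteq> dom p" "m = enc x"
      "translation p m = Some (enc (shift p x))"
    by (rule in_dom_translationE)
  have "p |` fst x = q |` fst x"
    using assms x(2) by (auto simp: map_le_def restrict_map_def fun_eq_iff)
  then have "shift p x = shift q x" by (simp add: prod_eq_iff snd_shift)
  moreover have "fst x \<subseteq> dom q" using x(2) map_le_implies_dom_le[OF assms] by blast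
  ultimately show "translation p m = translation q m" using x by (simp add: translation_enc)
qed

text \<open>Toggling reverses parity and thus exchanges the two distinguished classes. It commutes
  with projections because restricting the code first to \<open>u\<close> and then to a smaller
  \<open>v\<close> gives its restriction to \<open>v\<close>.\<close>

lemma partial_iso_translation:
  assumes d: "d \<in> positions"
  shows "partial_iso vocab (parity_model False) (parity_model True) (translation (code d))"
proof (rule partial_iso_relationalI)
  let ?f = "translation (code d)" and ?s = "shift (code d)"
  show "Funs vocab = {}" by simp
  show "dom ?f \<subseteq> universe (parity_model False)"
    by (auto simp: translation_def split: if_splits)
  show "ran ?f \<subseteq> universe (parity_model True)"
  proof
    fix m assume "m \<in> ran ?f"
    then obtain k where k: "?f k = Some m" by (auto simp: ran_def)
    then have "k \<in> dom ?f" by blast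
    then obtain x where "x \<in> elements" "fst x \<subseteq> dom (code d)" "?f k = Some (enc (?s x))"
      by (rule in_dom_translationE)
    then show "m \<in> universe (parity_model True)"
      using k shift_in_elements[OF _ d] enc_in_Field by simp
  qed
  show "inj_on ?f (dom ?f)"
  proof (rule inj_onI)
    fix k m assume km: "k \<in> dom ?f" "m \<in> dom ?f" and eq: "?f k = ?f m"
    obtain x where x: "x \<in> elements" "fst x \<subseteq> dom (code d)" "k = enc x" "?f k = Some (enc (?s x))"
      using km(1) by (rule in_dom_translationE)
    obtain y where y: "y \<in> elements" "fst y \<subseteq> dom (code d)" "m = enc y" "?f m = Some (enc (?s y))"
      using km(2) by (rule in_dom_translationE)
    have "?s x = ?s y" using eq x y shift_in_elements[OF _ d] enc_eq_iff by simp
    then have "x = y" by (metis shift_shift)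
    then show "k = m" using x y by simp
  qed
  fix R :: "'a set" and xs assume "xs \<in> tuples (dom ?f) (rarity vocab R)"
  then obtain k m where km: "xs = [k, m]" "k \<in> dom ?f" "m \<in> dom ?f"
    by (auto simp: tuples_def length_Suc_conv numeral_2_eq_2)
  obtain x where x: "x \<in> elements" "fst x \<subseteq> dom (code d)" "k = enc x" "?f k = Some (enc (?s x))"
    using km(2) by (rule in_dom_translationE)
  obtain y where y: "y \<in> elements" "fst y \<subseteq> dom (code d)" "m = enc y" "?f m = Some (enc (?s y))"
    using km(3) by (rule in_dom_translationE)
  note s = shift_in_elements[OF x(1) d x(2)] shift_in_elements[OF y(1) d y(2)]
  have fin: "finite (snd x)" using x(1) by (auto simp: elements_def)
  have inj: "?s x = ?s y \<longleftrightarrow> x = y" by (metis shift_shift)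
  have "[enc x, enc y] \<in> rinterp (parity_model False) R \<longleftrightarrow>
      [enc (?s x), enc (?s y)] \<in> rinterp (parity_model True) R"
  proof (cases "R = {}")
    case True
    then show ?thesis
      using x(1) y(1) s odd_card_toggle[OF fin] by (simp add: rinterp_parity inj snd_shift)
  next
    case False
    have "snd (?s y) = proj (fst y) (snd (?s x)) \<longleftrightarrow> snd y = proj (fst y) (snd x)"
      if "fst y \<subseteq> fst x"
    proof -
      have "proj (fst y) (snd (?s x)) = toggle (proj (fst y) (snd x)) (code d |` fst y)"
        using that by (simp add: snd_shift proj_toggle[OF fin] inf.absorb2)
      then show ?thesis by (metis snd_shift toggle_toggle)
    qed
    then show ?thesis using x(1) y(1) s False by (auto simp: rinterp_proj)
  qed
  then show "xs \<in> rinterp (parity_model False) R \<longleftrightarrow>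
      map (\<lambda>x. the (?f x)) xs \<in> rinterp (parity_model True) R"
    using km x y by simp
qed

text \<open>The implication yields an element of \<open>Field \<kappa>\<close> even for an
  \<open>S\<close> without a bound: at stages without predecessor AIS is under no restriction on the
  sets.\<close>

definition above :: "'a set \<Rightarrow> 'a" where
  "above S = (SOME b. b \<in> Field \<kappa> \<and> ((\<exists>c \<in> Field \<kappa>. \<forall>m\<in>S. snd ` fst (dec m) \<subseteq> underS \<kappa> c) \<longrightarrow>
     (\<forall>m\<in>S. snd ` fst (dec m) \<subseteq> underS \<kappa> b)))"

text \<open>Regularity is applied twice: to the countably many second coordinates of one element,
  \<kappa> being uncountable, and to the fewer than \<kappa> bounds so obtained.\<close>

lemma above_in_Field: "above S \<in> Field \<kappa>"
  and above_bound: "S \<subseteq> Field \<kappa> \<Longrightarrow> |S| <o \<kappa> \<Longrightarrow> m \<in> S \<Longrightarrow> snd ` fst (dec m) \<subseteq> underS \<kappa> (above S)"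
proof -
  let ?Q = "\<lambda>b. \<forall>m\<in>S. snd ` fst (dec m) \<subseteq> underS \<kappa> b"
  have "\<exists>b. b \<in> Field \<kappa> \<and> ((\<exists>c \<in> Field \<kappa>. ?Q c) \<longrightarrow> ?Q b)"
    using infinite_Field by (metis ex_in_conv finite.emptyI)
  then have *: "above S \<in> Field \<kappa> \<and> ((\<exists>c \<in> Field \<kappa>. ?Q c) \<longrightarrow> ?Q (above S))"
    unfolding above_def by (rule someI_ex)
  then show "above S \<in> Field \<kappa>" by blast
  assume S: "S \<subseteq> Field \<kappa>" "|S| <o \<kappa>" and m: "m \<in> S"
  have "\<exists>c. c \<in> Field \<kappa> \<and> snd ` fst (dec k) \<subseteq> underS \<kappa> c" if k: "k \<in> S" for k
  proof -
    have "k \<in> Field \<kappa>" using k S(1) by blast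
    then obtain x where "x \<in> elements" "k = enc x" by (rule Field_encE)
    then have "countable (snd ` fst (dec k))" "snd ` fst (dec k) \<subseteq> Field \<kappa>"
      by (auto simp: dec_enc elements_def)
    then show ?thesis using strictly_bounded countable_ordLess by blast
  qed
  then obtain c where c: "\<And>k. k \<in> S \<Longrightarrow> c k \<in> Field \<kappa> \<and> snd ` fst (dec k) \<subseteq> underS \<kappa> (c k)" by metis
  have "|c ` S| <o \<kappa>" using S(2) card_of_image ordLeq_ordLess_trans by blast
  then obtain b where b: "b \<in> Field \<kappa>" "c ` S \<subseteq> underS \<kappa> b" using strictly_bounded c by blast
  have "underS \<kappa> (c k) \<subseteq> underS \<kappa> b" if "k \<in> S" for k
    using b(2) that wo.TRANS wo.ANTISYM by (intro underS_incr) (auto simp: underS_def)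
  then have "?Q b" using c by blast
  then show "snd ` fst (dec m) \<subseteq> underS \<kappa> (above S)" using * b(1) m by blast
qed


section \<open>The strategy of ISO\<close>

abbreviation tree :: "('a \<rightharpoonup> 'a) rel" where
  "tree \<equiv> family_tree \<kappa> \<F>"

lemma well_order_ords: "Well_order (ords T)"
  unfolding ords_def using cardSuc_Card_order[OF card_of_Card_order[of "Field T"]]
  by (simp add: card_order_on_well_order_on)

text \<open>
  The bound attached to \<open>\<gamma>\<close> takes care of the sets that AIS plays at the stage at which \<open>\<gamma>\<close> enters
  the domain of the node.  Some \<open>\<gamma>\<close> enters at each successor stage, because the nodes increase
  strictly, so the levels of the nodes never need to be computed.
\<close>

definition position ::
  "(('a \<rightharpoonup> 'a) ordinal \<Rightarrow> 'a \<rightharpoonup> 'a) \<Rightarrow> (('a \<rightharpoonup> 'a) ordinal \<Rightarrow> 'a set) \<Rightarrow>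
   (('a \<rightharpoonup> 'a) ordinal \<Rightarrow> 'a set) \<Rightarrow> ('a \<rightharpoonup> 'a) ordinal \<Rightarrow> 'a \<rightharpoonup> 'a \<times> 'a" where
  "position z A1 A2 \<alpha> \<gamma> = map_option
     (Pair (above (A1 (entry (ords tree) z \<alpha> \<gamma>) \<union> A2 (entry (ords tree) z \<alpha> \<gamma>)))) (z \<alpha> \<gamma>)"

lemma dom_position: "dom (position z A1 A2 \<alpha>) = dom (z \<alpha>)"
  by (auto simp: position_def)

lemma position_in_positions:
  assumes "z \<alpha> \<in> \<F>" "Order_Relation.ofilter \<kappa> (dom (z \<alpha>))"
  shows "position z A1 A2 \<alpha> \<in> positions"
proof -
  have "(\<lambda>\<gamma>. map_option snd (position z A1 A2 \<alpha> \<gamma>)) = z \<alpha>"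
    by (simp add: position_def fun_eq_iff option.map_comp comp_def option.map_ident)
  moreover have "ran (z \<alpha>) \<subseteq> Field \<kappa>" using assms(1) family by (auto simp: partial_functions_def)
  then have "ran (position z A1 A2 \<alpha>) \<subseteq> Field \<kappa> \<times> Field \<kappa>"
    by (auto simp: position_def ran_def above_in_Field)
  ultimately show ?thesis using assms by (simp add: positions_def dom_position)
qed

text \<open>A point in the domain of \<open>z \<beta>\<close> has entered by stage
  \<open>\<beta>\<close>, so its entry stage, and with it its bound, is the same when computed at
  \<open>\<alpha>\<close>.\<close>

lemma position_mono:
  assumes "\<beta> \<in> under (ords tree) \<alpha>" "z \<beta> \<subseteq>\<^sub>m z \<alpha>"
  shows "position z A1 A2 \<beta> \<subseteq>\<^sub>m position z A1 A2 \<alpha>"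
  unfolding map_le_def dom_position
proof
  fix \<gamma> assume \<gamma>: "\<gamma> \<in> dom (z \<beta>)"
  interpret O: wo_rel "ords tree" using well_order_ords by (simp add: wo_rel_def)
  have "\<beta> \<in> Field (ords tree)" using assms(1) by (auto simp: under_def Field_def)
  note e = entry_first[OF well_order_ords this, of \<gamma> z, OF \<gamma>]
  then have "entry (ords tree) z \<beta> \<gamma> \<in> under (ords tree) \<alpha>"
    using assms(1) transD[OF O.TRANS] unfolding under_def by blast
  then have "entry (ords tree) z \<alpha> \<gamma> = entry (ords tree) z \<beta> \<gamma>"
    using e by (intro entry_eqI well_order_ords) auto
  moreover have "z \<beta> \<gamma> = z \<alpha> \<gamma>" using assms(2) \<gamma> by (simp add: map_le_def)
  ultimately show "position z A1 A2 \<beta> \<gamma> = position z A1 A2 \<alpha> \<gamma>" by (simp add: position_def)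
qed

text \<open>A strategy receives only the history up to the current stage. Entry stages refer to
  nothing later, so ISO can compute the position from it.\<close>

lemma position_restrict:
  assumes "\<alpha> \<in> Field (ords tree)"
  defines "U \<equiv> under (ords tree) \<alpha>"
  shows "position (restrict z U) (restrict A1 U) (restrict A2 U) \<alpha> = position z A1 A2 \<alpha>"
proof
  fix \<gamma>
  interpret O: wo_rel "ords tree" using well_order_ords by (simp add: wo_rel_def)
  have \<alpha>: "\<alpha> \<in> U" using assms(1) O.REFL by (simp add: U_def Refl_under_in)
  show "position (restrict z U) (restrict A1 U) (restrict A2 U) \<alpha> \<gamma> = position z A1 A2 \<alpha> \<gamma>"
  proof (cases "\<gamma> \<in> dom (z \<alpha>)")
    case True
    note e = entry_first[OF well_order_ords assms(1), of \<gamma> z, OF True]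
    have "underS (ords tree) (entry (ords tree) z \<alpha> \<gamma>) \<subseteq> U"
      using e transD[OF O.TRANS] unfolding U_def under_def underS_def by blast
    then have "entry (ords tree) (restrict z U) \<alpha> \<gamma> = entry (ords tree) z \<alpha> \<gamma>"
      using e by (intro entry_eqI well_order_ords) (auto simp: U_def)
    then show ?thesis using \<alpha> e by (simp add: position_def U_def)
  qed (use \<alpha> in \<open>auto simp: position_def\<close>)
qed

lemma EF_equivalent_parity_models:
  "EF_equivalent tree \<kappa> vocab (parity_model False) (parity_model True)"
  unfolding EF_equivalent_def winning_strategy_def
proof (intro exI allI impI)
  let ?O = "ords tree" and ?M1 = "parity_model False" and ?M2 = "parity_model True"
  \<comment> \<open>ISO answers with the translation by the code of the current position; it extends
    the earlier maps because codes grow with the position.\<close>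
  let ?\<sigma> = "\<lambda>\<alpha> z A1 A2 f. translation (code (position z A1 A2 \<alpha>))"
  fix \<alpha> z A1 A2 f
  assume hyp: "\<alpha> \<in> Field ?O \<and> (\<forall>\<beta> \<in> under ?O \<alpha>.
    AIS_legal tree \<kappa> ?M1 ?M2 z A1 A2 \<beta> \<and> follows tree ?\<sigma> z A1 A2 f \<beta>)"
  interpret O: wo_rel ?O using well_order_ords by (simp add: wo_rel_def)
  have under_Field: "\<beta> \<in> Field ?O" if "\<beta> \<in> under ?O \<alpha>" for \<beta>
    using that by (auto simp: under_def Field_def)
  have under_trans: "\<delta> \<in> under ?O \<beta>" if "\<delta> \<in> under ?O \<gamma>" "\<gamma> \<in> under ?O \<beta>" for \<beta> \<gamma> \<delta>
    using that transD[OF O.TRANS] unfolding under_def by blast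
  have underS_under: "\<delta> \<in> under ?O \<beta>" if "\<delta> \<in> underS ?O \<beta>" for \<beta> \<delta>
    using that unfolding under_def underS_def by blast
  have \<alpha>: "\<alpha> \<in> under ?O \<alpha>" using hyp O.REFL by (simp add: Refl_under_in)
  have node: "z \<beta> \<in> \<F>" "Order_Relation.ofilter \<kappa> (dom (z \<beta>))" if "\<beta> \<in> under ?O \<alpha>" for \<beta>
  proof -
    have "z \<beta> \<in> Field tree" using hyp that unfolding AIS_legal_def has_level_def by blast
    then show "z \<beta> \<in> \<F>" "Order_Relation.ofilter \<kappa> (dom (z \<beta>))"
      unfolding Field_def family_tree_def by blast+
  qed
  have below: "z \<delta> \<subseteq>\<^sub>m z \<beta> \<and> z \<delta> \<noteq> z \<beta>" if "\<beta> \<in> under ?O \<alpha>" "\<delta> \<in> underS ?O \<beta>" for \<beta> \<delta>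
  proof -
    have "z \<delta> \<in> underS tree (z \<beta>)" using hyp that unfolding AIS_legal_def by blast
    then show ?thesis unfolding underS_def family_tree_def by blast
  qed
  let ?p = "\<lambda>\<beta>. position z A1 A2 \<beta>"
  have pos: "?p \<beta> \<in> positions" if "\<beta> \<in> under ?O \<alpha>" for \<beta>
    using node[OF that] by (rule position_in_positions)
  have mono: "translation (code (?p \<delta>)) \<subseteq>\<^sub>m translation (code (?p \<beta>))"
    if "\<beta> \<in> under ?O \<alpha>" "\<delta> \<in> underS ?O \<beta>" for \<beta> \<delta>
    using that below[OF that] underS_under under_trans
    by (intro translation_mono code_mono pos position_mono) blast+
  have succ: "f \<beta> = translation (code (?p \<beta>))"
    if \<beta>: "\<beta> \<in> under ?O \<alpha>" and ex: "\<exists>\<delta>. is_succ ?O \<delta> \<beta>" for \<beta>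
  proof -
    have "follows tree ?\<sigma> z A1 A2 f \<beta>" using hyp \<beta> by blast
    then show ?thesis
      using ex position_restrict[OF under_Field[OF \<beta>]] unfolding follows_def by simp
  qed
  \<comment> \<open>At a stage without predecessor the union can be smaller than the translation: at
    stage 0 it is empty, while elements over the empty set of coordinates are translated.\<close>
  have approx: "f \<beta> \<subseteq>\<^sub>m translation (code (?p \<beta>))" if "\<beta> \<in> under ?O \<alpha>" for \<beta>
    using that
  proof (induction \<beta> rule: O.well_order_induct)
    case (1 \<beta>)
    show ?case
    proof (cases "\<exists>\<delta>. is_succ ?O \<delta> \<beta>")
      case True
      then show ?thesis using succ[OF 1(2)] by simp
    next
      case False
      have "follows tree ?\<sigma> z A1 A2 f \<beta>" using hyp 1(2) by blast
      then have union: "\<forall>x y. f \<beta> x = Some y \<longleftrightarrow> (\<exists>\<delta> \<in> underS ?O \<beta>. f \<delta> x = Some y)"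
        unfolding follows_def if_not_P[OF False] .
      have "translation (code (?p \<beta>)) x = Some y" if f: "f \<beta> x = Some y" for x y
      proof -
        obtain \<delta> where \<delta>: "\<delta> \<in> underS ?O \<beta>" "f \<delta> x = Some y"
          using union[THEN spec, THEN spec, THEN iffD1, OF f] by blast
        then have "f \<delta> \<subseteq>\<^sub>m translation (code (?p \<delta>))"
        proof -
          have "\<delta> \<noteq> \<beta> \<and> (\<delta>, \<beta>) \<in> ?O" using \<delta>(1) unfolding underS_def by blast
          moreover have "\<delta> \<in> under ?O \<alpha>" using under_trans underS_under \<delta>(1) 1(2) by blast
          ultimately show ?thesis using 1(1) by blast
        qed
        then have "translation (code (?p \<delta>)) x = Some y"
          using \<delta>(2) by (metis domI map_le_def)
        then show ?thesis using mono[OF 1(2) \<delta>(1)] by (metis domI map_le_def)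
      qed
      then show ?thesis by (auto simp: map_le_def)
    qed
  qed
  have "partial_iso vocab ?M1 ?M2 (f \<alpha>)"
    by (rule partial_iso_submap[OF partial_iso_translation[OF pos[OF \<alpha>]] approx[OF \<alpha>]])
  moreover have "f \<beta> \<subseteq>\<^sub>m f \<alpha> \<and> A1 \<alpha> \<subseteq> dom (f \<alpha>) \<and> A2 \<alpha> \<subseteq> ran (f \<alpha>)"
    if s: "is_succ ?O \<beta> \<alpha>" for \<beta>
  proof -
    have f\<alpha>: "f \<alpha> = translation (code (?p \<alpha>))" using succ[OF \<alpha>] s by blast
    have eq: "underS ?O \<alpha> = under ?O \<beta>" and \<beta>F: "\<beta> \<in> Field ?O" using s by (auto simp: is_succ_def)
    have \<beta>: "\<beta> \<in> underS ?O \<alpha>" unfolding eq using \<beta>F O.REFL by (simp add: Refl_under_in)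
    have "f \<beta> \<subseteq>\<^sub>m f \<alpha>"
      unfolding f\<alpha> using approx[OF underS_under[OF \<beta>]] mono[OF \<alpha> \<beta>] by (rule map_le_trans)
    moreover
    \<comment> \<open>A new point exists because \<open>z \<alpha>\<close> properly extends
      \<open>z \<beta>\<close>. Its bound will be computed from \<open>A1 \<alpha>\<close> and
      \<open>A2 \<alpha>\<close>.\<close>
    obtain \<gamma> where \<gamma>: "\<gamma> \<in> dom (z \<alpha>)" "\<gamma> \<notin> dom (z \<beta>)"
    proof -
      have "\<not> dom (z \<alpha>) \<subseteq> dom (z \<beta>)"
      proof
        assume "dom (z \<alpha>) \<subseteq> dom (z \<beta>)"
        then have "z \<alpha> \<subseteq>\<^sub>m z \<beta>" using below[OF \<alpha> \<beta>] unfolding map_le_def by (metis subsetD)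
        then show False using below[OF \<alpha> \<beta>] map_le_antisym by blast
      qed
      then show thesis using that by blast
    qed
    \<comment> \<open>Every stage before \<open>\<alpha>\<close> is at most the predecessor
      \<open>\<beta>\<close>, so \<open>\<alpha>\<close> is the entry stage of
      \<open>\<gamma>\<close>.\<close>
    have "\<gamma> \<notin> dom (z \<delta>)" if \<delta>: "\<delta> \<in> underS ?O \<alpha>" for \<delta>
    proof (cases "\<delta> = \<beta>")
      case False
      have "\<delta> \<in> under ?O \<beta>" using \<delta> by (simp only: eq)
      with False have "\<delta> \<in> underS ?O \<beta>" unfolding under_def underS_def by blast
      then have "z \<delta> \<subseteq>\<^sub>m z \<beta>" using below underS_under[OF \<beta>] by blast
      then show ?thesis using \<gamma>(2) map_le_implies_dom_le by blast
    qed (use \<gamma> in simp)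
    then have "entry ?O z \<alpha> \<gamma> = \<alpha>" using \<alpha> \<gamma>(1) by (intro entry_eqI well_order_ords) auto
    then obtain y where y: "?p \<alpha> \<gamma> = Some (above (A1 \<alpha> \<union> A2 \<alpha>), y)"
      using \<gamma>(1) by (auto simp: position_def)
    have A: "A1 \<alpha> \<union> A2 \<alpha> \<subseteq> Field \<kappa>" "|A1 \<alpha> \<union> A2 \<alpha>| <o cone +c \<kappa>"
      using hyp \<alpha> s unfolding AIS_legal_def by auto
    have "cone +c \<kappa> =o \<kappa>"
      using cinfinite card_order infinite_Field
      by (intro csum_absorb2) (auto simp: cone_def intro!: Card_order_singl_ordLeq)
    then have small: "|A1 \<alpha> \<union> A2 \<alpha>| <o \<kappa>" using A(2) ordLess_ordIso_trans by blast
    \<comment> \<open>The bound at \<open>\<gamma>\<close> exceeds all second coordinates of the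
      elements played, so \<open>\<gamma>\<close> is a hit for each of their coordinates.\<close>
    have dom: "fst x \<subseteq> dom (code (?p \<alpha>))" if "x \<in> elements" "enc x \<in> A1 \<alpha> \<union> A2 \<alpha>" for x
    proof
      fix q assume "q \<in> fst x"
      then have "snd q \<in> underS \<kappa> (above (A1 \<alpha> \<union> A2 \<alpha>))"
        using above_bound[OF A(1) small that(2)] that(1) by (auto simp: dec_enc)
      then have "hits (?p \<alpha>) q \<gamma>" using y by (auto simp: hits_def)
      then show "q \<in> dom (code (?p \<alpha>))" using dom_code by blast
    qed
    have "A1 \<alpha> \<subseteq> dom (f \<alpha>)"
    proof
      fix m assume m: "m \<in> A1 \<alpha>"
      then obtain x where x: "x \<in> elements" "m = enc x" using A(1) Field_encE by blast
      then have "f \<alpha> m = Some (enc (shift (code (?p \<alpha>)) x))"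
        using dom[of x] m unfolding f\<alpha> by (simp add: translation_enc)
      then show "m \<in> dom (f \<alpha>)" by blast
    qed
    moreover have "A2 \<alpha> \<subseteq> ran (f \<alpha>)"
    proof
      fix m assume m: "m \<in> A2 \<alpha>"
      then obtain x where x: "x \<in> elements" "m = enc x" using A(1) Field_encE by blast
      then have d: "fst x \<subseteq> dom (code (?p \<alpha>))" using dom[of x] m by simp
      \<comment> \<open>Shifting is an involution, so the translate of \<open>m\<close> is also its
        preimage.\<close>
      then have "f \<alpha> (enc (shift (code (?p \<alpha>)) x)) = Some m"
        using shift_in_elements[OF x(1) pos[OF \<alpha>] d] x(2) unfolding f\<alpha> by (simp add: translation_enc)
      then show "m \<in> ran (f \<alpha>)" by (rule ranI)
    qed
    ultimately show ?thesis by blast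
  qed
  ultimately show "ISO_legal tree vocab ?M1 ?M2 A1 A2 f \<alpha>"
    unfolding ISO_legal_def by blast
qed

end

theorem theorem1p5:
  fixes \<kappa> :: "'a rel" and \<F> :: "('a \<rightharpoonup> 'a) set"
  assumes "Card_order \<kappa>" and "cinfinite \<kappa>"
    and "regularCard \<kappa>"
    and "\<kappa> ^c natLeq =o \<kappa>"
    and "\<F> \<subseteq> partial_functions \<kappa>"
    and "\<forall>f \<in> partial_functions \<kappa>.
           f \<in> \<F> \<longleftrightarrow> (\<forall>u. u \<subseteq> dom f \<and> countable u \<longrightarrow> f |` u \<in> \<F>)"
    and "\<not> (\<exists>f \<in> \<F>. dom f = Field \<kappa>)"
  shows "\<exists>(V :: ('a set, 'a set) vocabulary) (M1 :: ('a set, 'a set, 'a) model)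
            (M2 :: ('a set, 'a set, 'a) model).
           is_model V M1 \<and> is_model V M2 \<and>
           |universe M1| =o \<kappa> \<and> |universe M2| =o \<kappa> \<and>
           \<not> isomorphic V M1 M2 \<and>
           EF_equivalent (family_tree \<kappa> \<F>) \<kappa> V M1 M2"
proof -
  interpret countably_closed_family \<kappa> \<F>
    using assms by unfold_locales
  show ?thesis
    using is_model_parity_model not_isomorphic EF_equivalent_parity_models
      card_of_Field_ordIso[OF assms(1)] universe_parity_model by metis
qed

end
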